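(* Let $N\ge2$, let $X$ and $Y$ be Banach spaces, and let $T_{j,k}\in L(X,Y)$ for each $k\in\mathbb N$ and $1\le j\le N$. If either (i) for each $1\le j\le N$ we have $\sum_{k=1}^\infty\frac1{\|T_{j,k}\|}<\infty$, or (ii) $X$ is a complex Hilbert space and for each $1\le j\le N$ we have $\sum_{k=1}^\infty\frac1{\|T_{j,k}\|^2}<\infty$, then there exists $x\in X$ such that $\lim_{k\to\infty}\|T_{j,k}x\|_Y=\infty$ for each $1\le j\le N$.
   Context: $X$ and $Y$ are non-trivial and over the same field $\mathbb K\in\{\mathbb R,\mathbb C\}$. $L(X,Y)$ is the space of bounded linear operators from $X$ to $Y$ with operator norm $\|\cdot\|$. *)

theory Defs
  imports "HOL-Analysis.Analysis"
begin

text \<open>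
  A type of this class is a copy of the real or of the complex field, absolute value included:
  \<open>to_complex\<close> identifies it with the subfield \<open>\<real>\<close> or \<open>UNIV\<close> of \<open>complex\<close>.
  Injectivity follows from \<open>norm_to_complex\<close>.
\<close>

class real_or_complex = real_normed_field +
  fixes to_complex :: "'a \<Rightarrow> complex"
  assumes to_complex_add: "to_complex (a + b) = to_complex a + to_complex b"
    and to_complex_mult: "to_complex (a * b) = to_complex a * to_complex b"
    and to_complex_one: "to_complex 1 = 1"
    and to_complex_scaleR: "to_complex (r *\<^sub>R a) = r *\<^sub>R to_complex a"
    and norm_to_complex: "cmod (to_complex a) = norm a"
    and range_to_complex: "range to_complex = \<real> \<or> range to_complex = UNIV"

instantiation real :: real_or_complex
begin

definition to_complex_real :: "real \<Rightarrow> complex"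
  where "to_complex_real = complex_of_real"

instance
  by standard (auto simp: to_complex_real_def Reals_def scaleR_conv_of_real)

end

instantiation complex :: real_or_complex
begin

definition to_complex_complex :: "complex \<Rightarrow> complex"
  where "to_complex_complex = (\<lambda>z. z)"

instance
  by standard (auto simp: to_complex_complex_def)

end

text \<open>
  Normed spaces over such a field. Addition, norm and multiplication by reals are those of the
  type; \<open>smul\<close> extends the latter to the scalar field. Completeness is the sort \<open>banach\<close>.
\<close>

locale normed_space_over = vector_space smul
  for smul :: "'k::real_or_complex \<Rightarrow> 'a::real_normed_vector \<Rightarrow> 'a" +
  assumes smul_of_real: "smul (of_real r) x = r *\<^sub>R x"
    and norm_smul: "norm (smul c x) = norm c * norm x"

text \<open>
  \<open>L(X, Y)\<close>. The elements of the library type \<open>X \<Rightarrow>\<^sub>L Y\<close> are the bounded real-linear maps, and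
  its norm is the operator norm.
\<close>

definition bounded_operators ::
  "('k::real_or_complex \<Rightarrow> 'a::real_normed_vector \<Rightarrow> 'a) \<Rightarrow>
   ('k \<Rightarrow> 'b::real_normed_vector \<Rightarrow> 'b) \<Rightarrow> ('a \<Rightarrow>\<^sub>L 'b) set"
  where "bounded_operators sX sY = {T. Vector_Spaces.linear sX sY (blinfun_apply T)}"

text \<open>
  The last assumption says both that the form is positive definite and that it induces the norm.
\<close>

locale hilbert_space_over = normed_space_over smul
  for smul :: "'k::real_or_complex \<Rightarrow> 'a::banach \<Rightarrow> 'a" +
  fixes ip :: "'a \<Rightarrow> 'a \<Rightarrow> 'k"
  assumes ip_add_left: "ip (x + y) z = ip x z + ip y z"
    and ip_smul_left: "ip (smul c x) y = c * ip x y"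
    and ip_hermitian: "to_complex (ip y x) = cnj (to_complex (ip x y))"
    and ip_norm: "ip x x = of_real ((norm x)\<^sup>2)"

definition complex_hilbert_space :: "('k::real_or_complex \<Rightarrow> 'a::banach \<Rightarrow> 'a) \<Rightarrow> bool"
  where "complex_hilbert_space smul \<longleftrightarrow>
    range (to_complex :: 'k \<Rightarrow> complex) = UNIV \<and> (\<exists>ip. hilbert_space_over smul ip)"

lemma normed_space_over_scaleR:
  "normed_space_over (scaleR :: real \<Rightarrow> 'a::real_normed_vector \<Rightarrow> 'a)"
  by unfold_locales (auto simp: algebra_simps)

lemma complex_hilbert_space_complex:
  "complex_hilbert_space ((*) :: complex \<Rightarrow> complex \<Rightarrow> complex)"
proof -
  have "hilbert_space_over ((*) :: complex \<Rightarrow> complex \<Rightarrow> complex) (\<lambda>x y. x * cnj y)"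
    by unfold_locales
      (auto simp: algebra_simps norm_mult scaleR_conv_of_real to_complex_complex_def
        simp flip: complex_norm_square)
  then show ?thesis
    by (auto simp: complex_hilbert_space_def to_complex_complex_def)
qed

end

theory Submission
  imports Defs "HOL-Complex_Analysis.Conformal_Mappings"
begin

text \<open>
  The \<open>N\<close> sequences of operators are interleaved into one sequence \<open>S\<close>; put \<open>r = 1\<close> in the
  Banach case and \<open>r = 2\<close> in the Hilbert case. Since \<open>1 / (norm (S i))^r\<close> is summable, there are
  weights \<open>a i > 0\<close> of total mass at most \<open>1\<close> with \<open>a i * (norm (S i))^r\<close> tending to infinity
  (\<open>slowly_larger_summable\<close>). So it is enough to find one vector \<open>x\<close> for which \<open>norm (S i x)\<close> is
  at least a constant times \<open>(a i) powr (1 / r) * norm (S i)\<close> for all \<open>i\<close>. Composing \<open>S i\<close> with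
  a functional that norms its value at a nearly norming unit vector \<open>z i\<close>, this becomes a plank
  problem: find a vector in the unit ball on which norm-one functionals \<open>f i\<close> are bounded below
  by prescribed widths.

  Banach case (Ball's plank theorem for symmetric bodies, \<open>ball_matrix\<close> and \<open>banach_plank\<close>).
  Look for \<open>x\<close> among the combinations of the \<open>z k\<close> with coefficients \<open>sqrt (w k) * \<mu> k\<close>, where
  \<open>\<mu>\<close> lies in the Euclidean unit ball. If the matrix \<open>f i (z k)\<close> were symmetric, then
  \<open>\<mu> k = \<plusminus>sqrt (w k)\<close> with signs maximising the associated quadratic form would do, which is
  Bang's argument (\<open>bang_signs\<close>). In general, a contraction \<open>V\<close> is chosen so that after
  multiplication by \<open>V\<close> and a rescaling of the rows the matrix becomes symmetric. Such a \<open>V\<close>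
  maximises a weighted product of the diagonal entries, and the optimality conditions provide
  both the symmetry and the bound on \<open>\<mu>\<close>. The coefficients \<open>sqrt (w k) * \<mu> k\<close> have uniformly
  small \<open>l\<^sup>1\<close> tails, so the finite solutions have a norm-convergent subsequence.

  Hilbert case (a complex plank theorem up to a constant, \<open>complex_plank_finite\<close> and
  \<open>hilbert_plank\<close>). Let \<open>p\<close> be a unit vector that nearly maximises the product of the
  \<open>cmod (F i x) ^ m i\<close>, where the multiplicities \<open>m i\<close> are proportional to \<open>a i\<close>. Along a
  complex line \<open>p + t q\<close> orthogonal to \<open>p\<close> this product is the modulus of a polynomial in \<open>t\<close>
  that grows at most like \<open>exp (M * (cmod t)\<^sup>2 / 2)\<close>, where \<open>M\<close> is the sum of the
  multiplicities. By the maximum principle such a polynomial has no zero of multiplicity \<open>m k\<close>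
  much closer to \<open>0\<close> than \<open>sqrt (m k / M)\<close>. Hence \<open>p\<close> is not too close to the kernel of any
  \<open>F k\<close>. Finitely many functionals are passed to infinitely many by a weak limit, obtained from
  nearly shortest elements of convex hulls (\<open>weak_limit_exists\<close>).
\<close>

section \<open>Functionals dominated by a seminorm\<close>

text \<open>
  Hahn-Banach, with partial functionals represented by their graphs. A linear subspace \<open>G\<close> of
  \<open>'a \<times> real\<close> on which \<open>r \<le> p x\<close> is automatically single-valued, because \<open>(0, r)\<close> and \<open>(0, - r)\<close>
  in \<open>G\<close> force \<open>r = 0\<close>; so Zorn's lemma can be applied to subspaces ordered by inclusion.
\<close>

lemma hahn_banach_real:
  fixes p :: "'a::real_vector \<Rightarrow> real" and z :: 'a
  assumes tri: "\<And>x y. p (x + y) \<le> p x + p y"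
    and hom: "\<And>c x. p (c *\<^sub>R x) = \<bar>c\<bar> * p x"
  obtains f where "linear f" "\<And>x. \<bar>f x\<bar> \<le> p x" "f z = p z"
proof -
  define \<A> where "\<A> = {G :: ('a \<times> real) set. subspace G \<and> (z, p z) \<in> G \<and> (\<forall>(x, r) \<in> G. r \<le> p x)}"
  have p_ge: "0 \<le> p x" for x
    using tri[of x "- x"] hom[of "-1" x] hom[of 0 x] by simp
  have "\<exists>M\<in>\<A>. \<forall>X\<in>\<A>. M \<subseteq> X \<longrightarrow> X = M"
  proof (rule subset_Zorn_nonempty)
    have "r \<le> p x" if "(x, r) \<in> span {(z, p z)}" for x r
    proof -
      from that obtain k where "(x, r) = k *\<^sub>R (z, p z)"
        by (auto simp: span_singleton)
      then show ?thesis
        using hom[of k z] p_ge[of z] by (simp add: mult_right_mono)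
    qed
    then have "span {(z, p z)} \<in> \<A>"
      by (auto simp: \<A>_def span_base)
    then show "\<A> \<noteq> {}" by blast
  next
    fix \<C> assume ne: "\<C> \<noteq> {}" and "subset.chain \<A> \<C>"
    then have sub: "\<C> \<subseteq> \<A>" and ch: "\<And>A B. A \<in> \<C> \<Longrightarrow> B \<in> \<C> \<Longrightarrow> A \<subseteq> B \<or> B \<subseteq> A"
      by (auto simp: subset_chain_def)
    have "subspace (\<Union>\<C>)"
    proof (rule subspaceI)
      show "0 \<in> \<Union>\<C>" using ne sub by (auto simp: \<A>_def intro: subspace_0)
    next
      fix u v assume "u \<in> \<Union>\<C>" "v \<in> \<Union>\<C>"
      then obtain A B where "A \<in> \<C>" "B \<in> \<C>" "u \<in> A" "v \<in> B" by blast
      moreover from this ch[of A B] have "u \<in> B \<and> v \<in> B \<or> u \<in> A \<and> v \<in> A" by blast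
      ultimately show "u + v \<in> \<Union>\<C>"
        using sub unfolding \<A>_def by (blast intro: subspace_add)
    next
      fix c u assume "u \<in> \<Union>\<C>"
      then show "c *\<^sub>R u \<in> \<Union>\<C>"
        using sub unfolding \<A>_def by (blast intro: subspace_scale)
    qed
    then show "\<Union>\<C> \<in> \<A>"
      using ne sub unfolding \<A>_def by blast
  qed
  then obtain G where G: "G \<in> \<A>" and max: "\<And>X. X \<in> \<A> \<Longrightarrow> G \<subseteq> X \<Longrightarrow> X = G"
    by blast
  have sG: "subspace G" and zG: "(z, p z) \<in> G" and le: "\<And>x r. (x, r) \<in> G \<Longrightarrow> r \<le> p x"
    using G by (auto simp: \<A>_def)
  have ex: "\<exists>r. (x, r) \<in> G" for x
  proof (rule ccontr)
    assume nx: "\<nexists>r. (x, r) \<in> G"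
    have cross: "r - p (y - x) \<le> p (y' + x) - r'" if "(y, r) \<in> G" "(y', r') \<in> G" for y r y' r'
    proof -
      have "(y + y', r + r') \<in> G" using subspace_add[OF sG that] by simp
      from le[OF this] tri[of "y - x" "y' + x"] show ?thesis by (simp add: algebra_simps)
    qed
    have zero: "(0, 0) \<in> G" using subspace_0[OF sG] by (simp add: zero_prod_def)
    \<comment> \<open>Any value of the extension at \<open>x\<close> between the two sides of \<open>cross\<close> is admissible.\<close>
    define c where "c = Sup ((\<lambda>(y, r). r - p (y - x)) ` G)"
    have up: "r - p (y - x) \<le> c" if "(y, r) \<in> G" for y r
      unfolding c_def
    proof (rule cSup_upper)
      show "bdd_above ((\<lambda>(y, r). r - p (y - x)) ` G)"
        using cross[OF _ zero] by (intro bdd_aboveI[of _ "p (0 + x) - 0"]) auto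
    qed (use that in force)
    have lo: "c \<le> p (y + x) - r" if "(y, r) \<in> G" for y r
      unfolding c_def using zero cross[OF _ that] by (intro cSup_least) auto
    have "span (insert (x, c) G) \<in> \<A>"
    proof -
      have "r \<le> p y" if "(y, r) \<in> span (insert (x, c) G)" for y r
      proof -
        from that obtain t where "(y, r) - t *\<^sub>R (x, c) \<in> span G"
          by (auto simp: span_insert)
        then have t: "(y - t *\<^sub>R x, r - t * c) \<in> G"
          using sG by (simp add: span_eq_iff[THEN iffD2])
        have sc: "((1/s) *\<^sub>R (y - t *\<^sub>R x), (1/s) * (r - t * c)) \<in> G" for s
          using subspace_scale[OF sG t, of "1/s"] by simp
        consider "t = 0" | "t > 0" | "t < 0" by linarith
        then show ?thesis
        proof cases
          case 1 then show ?thesis using le[OF t] by simp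
        next
          case 2
          have "c \<le> p ((1/t) *\<^sub>R (y - t *\<^sub>R x) + x) - (1/t) * (r - t * c)" by (rule lo[OF sc])
          also have "(1/t) *\<^sub>R (y - t *\<^sub>R x) + x = (1/t) *\<^sub>R y" using 2 by (simp add: algebra_simps)
          finally show ?thesis using 2 hom[of "1/t" y] by (simp add: field_simps)
        next
          case 3
          have "(1/(-t)) * (r - t * c) - p ((1/(-t)) *\<^sub>R (y - t *\<^sub>R x) - x) \<le> c" by (rule up[OF sc])
          also have "(1/(-t)) *\<^sub>R (y - t *\<^sub>R x) - x = (1/(-t)) *\<^sub>R y" using 3 by (simp add: algebra_simps)
          finally show ?thesis using 3 hom[of "1/(-t)" y] by (simp add: field_simps)
        qed
      qed
      then show ?thesis using zG by (auto simp: \<A>_def intro: span_base)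
    qed
    then have "span (insert (x, c) G) = G" by (rule max) (auto intro: span_base)
    then have "(x, c) \<in> G" using span_base[of "(x, c)" "insert (x, c) G"] by simp
    with nx show False by blast
  qed
  have uniq: "r = r'" if "(x, r) \<in> G" "(x, r') \<in> G" for x r r'
  proof -
    have "(0, r - r') \<in> G" "(0, r' - r) \<in> G"
      using subspace_diff[OF sG that] subspace_diff[OF sG that(2,1)] by simp_all
    from le[OF this(1)] le[OF this(2)] hom[of 0 0] show ?thesis by simp
  qed
  define f where "f x = (SOME r. (x, r) \<in> G)" for x
  have f: "(x, f x) \<in> G" for x unfolding f_def by (rule someI_ex[OF ex])
  have lin: "linear f"
  proof (rule linearI)
    show "f (x + y) = f x + f y" for x y
      using subspace_add[OF sG f[of x] f[of y]] by (intro uniq[OF f]) simp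
    show "f (c *\<^sub>R x) = c *\<^sub>R f x" for c x
      using subspace_scale[OF sG f[of x], of c] by (intro uniq[OF f]) simp
  qed
  show thesis
  proof
    show "linear f" by (rule lin)
    show "f z = p z" by (rule uniq[OF f zG])
    fix x
    have "- f x \<le> p x"
      using le[OF f[of "- x"]] hom[of "-1" x] linear_neg[OF lin] by simp
    then show "\<bar>f x\<bar> \<le> p x" using le[OF f[of x]] by simp
  qed
qed

text \<open>
  The usual complexification: a real functional \<open>f\<close> is the real part of the complex functional
  \<open>f x - \<i> f (\<i> x)\<close>, and rotating the argument turns a bound on real parts into a bound on
  moduli.
\<close>

lemma hahn_banach_complex:
  fixes cs :: "complex \<Rightarrow> 'a::real_normed_vector \<Rightarrow> 'a" and p :: "'a \<Rightarrow> real"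
  assumes "normed_space_over cs"
    and tri: "\<And>x y. p (x + y) \<le> p x + p y"
    and hom: "\<And>c x. p (cs c x) = cmod c * p x"
  obtains F where "\<And>x y. F (x + y) = F x + F y" "\<And>c x. F (cs c x) = c * F x"
    "\<And>x. cmod (F x) \<le> p x" "cmod (F z) = p z"
proof -
  interpret normed_space_over cs by fact
  have real: "cs (complex_of_real r) x = r *\<^sub>R x" for r x
    by (rule smul_of_real)
  obtain f where lin: "linear f" and le: "\<And>x. \<bar>f x\<bar> \<le> p x" and fz: "f z = p z"
    using hahn_banach_real[of p z] tri hom real by (metis norm_of_real)
  define F where "F x = Complex (f x) (- f (cs \<i> x))" for x
  have add: "F (x + y) = F x + F y" for x y
    by (simp add: F_def linear_add[OF lin] scale_right_distrib complex_eq_iff)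
  have cscale: "F (cs c x) = c * F x" for c x
  proof -
    have dec: "cs d x = Re d *\<^sub>R x + Im d *\<^sub>R cs \<i> x" for d
    proof -
      have "cs d x = cs (complex_of_real (Re d) + complex_of_real (Im d) * \<i>) x"
        by (metis complex_eq mult.commute)
      then show ?thesis by (simp only: scale_left_distrib real flip: scale_scale)
    qed
    have "f (cs d x) = Re d * f x + Im d * f (cs \<i> x)" for d
      by (subst dec) (simp add: linear_add[OF lin] linear_scale[OF lin])
    from this[of c] this[of "\<i> * c"] show ?thesis
      by (simp add: F_def complex_eq_iff algebra_simps)
  qed
  have bound: "cmod (F x) \<le> p x" for x
  proof -
    obtain u where u: "cmod u = 1" "u * F x = complex_of_real (cmod (F x))"
    proof (cases "F x = 0")
      case True then show ?thesis using that[of 1] by simp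
    next
      case False
      show ?thesis
        by (rule that[of "cnj (F x) / cmod (F x)"])
           (use False in \<open>simp_all add: norm_divide complex_norm_square[symmetric] power2_eq_square mult.commute[of "cnj _"]\<close>)
    qed
    have "cmod (F x) = Re (F (cs u x))" by (simp add: cscale u(2))
    also have "\<dots> = f (cs u x)" by (simp add: F_def)
    also have "\<dots> \<le> p x" using le[of "cs u x"] by (simp add: hom u(1))
    finally show ?thesis .
  qed
  have "p z \<le> cmod (F z)"
    using complex_Re_le_cmod[of "F z"] by (simp add: F_def fz)
  then show thesis using that[of F] add cscale bound by (simp add: antisym)
qed

section \<open>Sequences and compactness\<close>

text \<open>
  This turns a perturbation inequality with second-order error into a first-order optimality
  condition.
\<close>

lemma nonpos_if_le_small_multiples:
  fixes S C \<delta> :: real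
  assumes "\<delta> > 0" and le: "\<And>t. 0 < t \<Longrightarrow> t < \<delta> \<Longrightarrow> S \<le> t * C"
  shows "S \<le> 0"
proof (rule ccontr)
  assume "\<not> S \<le> 0"
  define t where "t = min (\<delta> / 2) (S / (2 * (\<bar>C\<bar> + 1)))"
  have t: "0 < t" "t < \<delta>" using \<open>\<delta> > 0\<close> \<open>\<not> S \<le> 0\<close> by (auto simp: t_def)
  have "t * C \<le> t * (\<bar>C\<bar> + 1)" using t by (intro mult_left_mono) auto
  also have "\<dots> \<le> S / (2 * (\<bar>C\<bar> + 1)) * (\<bar>C\<bar> + 1)" by (intro mult_right_mono) (auto simp: t_def)
  also have "\<dots> = S / 2" by (simp add: field_simps)
  finally show False using le[OF t] \<open>\<not> S \<le> 0\<close> by simp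
qed

lemma compact_product_set:
  fixes S :: "'a \<Rightarrow> 'b::topological_space set"
  assumes "\<And>i. compact (S i)"
  shows "compact {f. \<forall>i. f i \<in> S i}"
proof -
  have "compactin (product_topology (\<lambda>i. euclidean) UNIV) (PiE UNIV S)"
    using assms by (subst compactin_PiE) (auto simp: compactin_euclidean_iff)
  then show ?thesis
    by (simp add: euclidean_product_topology compactin_euclidean_iff PiE_def Pi_def)
qed

lemma pointwise_convergent_subsequence:
  fixes f :: "nat \<Rightarrow> nat \<Rightarrow> 'b::metric_space"
  assumes "\<And>k. compact (S k)" and "\<And>n k. f n k \<in> S k"
  obtains l r where "strict_mono r" "\<And>k. (\<lambda>n. f (r n) k) \<longlonglongrightarrow> l k"
proof -
  have "compact {g. \<forall>k. g k \<in> S k}" using assms(1) by (rule compact_product_set)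
  then have "seq_compact {g. \<forall>k. g k \<in> S k}" by (simp add: compact_eq_seq_compact_metric)
  moreover have "\<forall>n. f n \<in> {g. \<forall>k. g k \<in> S k}" using assms(2) by simp
  ultimately obtain l r where r: "strict_mono r" "(f \<circ> r) \<longlonglongrightarrow> l"
    by (rule seq_compactE)
  have "(\<lambda>n. f (r n) k) \<longlonglongrightarrow> l k" for k
    using continuous_on_tendsto_compose[OF continuous_on_product_coordinates[of k] r(2)] by simp
  with r(1) show thesis by (rule that)
qed

lemma Cauchy_if_nearly_constant:
  fixes X :: "nat \<Rightarrow> 'a::metric_space"
  assumes "\<And>e. e > 0 \<Longrightarrow> \<exists>y. eventually (\<lambda>n. dist (X n) y < e) sequentially"
  shows "Cauchy X"
proof (rule metric_CauchyI)
  fix e :: real assume "e > 0"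
  then obtain y N where "\<And>n. n \<ge> N \<Longrightarrow> dist (X n) y < e / 2"
    using assms[of "e / 2"] by (auto simp: eventually_sequentially)
  then show "\<exists>N. \<forall>m\<ge>N. \<forall>n\<ge>N. dist (X m) (X n) < e"
    using dist_triangle_half_l by (metis dist_commute)
qed

text \<open>
  Dividing the terms of a convergent series by the square roots of its tails \<open>r i\<close> keeps it
  convergent, because \<open>(r i - r (Suc i)) / sqrt (r i) \<le> 2 * (sqrt (r i) - sqrt (r (Suc i)))\<close>
  telescopes.
\<close>

lemma slowly_larger_summable:
  fixes u :: "nat \<Rightarrow> real"
  assumes pos: "\<And>i. u i > 0" and "summable u"
  obtains a where "\<And>i. a i > 0" "\<And>n. (\<Sum>i<n. a i) \<le> 1"
    "filterlim (\<lambda>i. a i / u i) at_top sequentially"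
proof -
  define r where "r i = (\<Sum>k. u (k + i))" for i
  have r_rec: "r i = u i + r (Suc i)" for i
    using suminf_split_head[of "\<lambda>k. u (k + i)"] \<open>summable u\<close>
    by (simp add: r_def)
  have rpos: "r i > 0" for i
    unfolding r_def using pos \<open>summable u\<close> by (intro suminf_pos) auto
  have r0: "r \<longlonglongrightarrow> 0"
  proof -
    have "(\<lambda>i. suminf u - (\<Sum>k<i. u k)) \<longlonglongrightarrow> suminf u - suminf u"
      using \<open>summable u\<close> by (intro tendsto_intros summable_LIMSEQ)
    moreover have "suminf u - (\<Sum>k<i. u k) = r i" for i
      using suminf_minus_initial_segment[OF \<open>summable u\<close>, of i] by (simp add: r_def)
    ultimately show ?thesis by simp
  qed
  define c where "c = 1 / (2 * sqrt (r 0))"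
  define a where "a i = c * (u i / sqrt (r i))" for i
  have c: "c > 0" using rpos by (simp add: c_def)
  have step: "u i / sqrt (r i) \<le> 2 * (sqrt (r i) - sqrt (r (Suc i)))" for i
  proof -
    define s t where "s = sqrt (r i)" and "t = sqrt (r (Suc i))"
    have st: "0 < s" "0 < t" using rpos by (auto simp: s_def t_def)
    have "u i = s\<^sup>2 - t\<^sup>2" using r_rec[of i] rpos[of i] rpos[of "Suc i"] by (simp add: s_def t_def)
    then have "u i \<le> 2 * (s - t) * s"
      using sum_squares_bound[of s t] by (simp add: algebra_simps power2_eq_square)
    then show ?thesis using st unfolding s_def[symmetric] t_def[symmetric] by (simp add: field_simps)
  qed
  have "(\<Sum>i<n. u i / sqrt (r i)) \<le> 2 * (sqrt (r 0) - sqrt (r n))" for n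
  proof (induction n)
    case (Suc n)
    then show ?case using step[of n] by simp
  qed simp
  then have sum: "(\<Sum>i<n. u i / sqrt (r i)) \<le> 2 * sqrt (r 0)" for n
    by (rule order_trans) (use rpos[of n] in simp)
  show thesis
  proof
    show "a i > 0" for i using c pos rpos by (simp add: a_def)
    show "(\<Sum>i<n. a i) \<le> 1" for n
    proof -
      have "(\<Sum>i<n. a i) = c * (\<Sum>i<n. u i / sqrt (r i))" by (simp add: a_def sum_distrib_left)
      also have "\<dots> \<le> c * (2 * sqrt (r 0))" using sum c by (intro mult_left_mono) auto
      also have "\<dots> = 1" using rpos[of 0] by (simp add: c_def)
      finally show ?thesis .
    qed
    have "filterlim (\<lambda>i. inverse (sqrt (r i))) at_top sequentially"
    proof (rule filterlim_inverse_at_top)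
      show "(\<lambda>i. sqrt (r i)) \<longlonglongrightarrow> 0" using tendsto_real_sqrt[OF r0] by simp
    qed (use rpos in simp)
    then have "filterlim (\<lambda>i. c * inverse (sqrt (r i))) at_top sequentially"
      by (rule filterlim_tendsto_pos_mult_at_top[OF tendsto_const c])
    moreover have "a i / u i = c * inverse (sqrt (r i))" for i
      using pos[of i] by (simp add: a_def field_simps)
    ultimately show "filterlim (\<lambda>i. a i / u i) at_top sequentially" by simp
  qed
qed

lemma blinfun_nearly_norming_vector:
  fixes T :: "'a::real_normed_vector \<Rightarrow>\<^sub>L 'b::real_normed_vector"
  assumes "T \<noteq> 0"
  obtains z where "norm z = 1" "norm T / 2 \<le> norm (T z)"
proof -
  have "\<exists>x. norm T / 2 * norm x < norm (T x)"
  proof (rule ccontr)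
    assume "\<nexists>x. norm T / 2 * norm x < norm (T x)"
    then have "norm T \<le> norm T / 2" by (intro norm_blinfun_bound) (auto simp: not_less)
    with assms show False by simp
  qed
  then obtain x where x: "norm T / 2 * norm x < norm (T x)" by blast
  then have "x \<noteq> 0" by auto
  show thesis
  proof
    show "norm ((1 / norm x) *\<^sub>R x) = 1" using \<open>x \<noteq> 0\<close> by simp
    show "norm T / 2 \<le> norm (T ((1 / norm x) *\<^sub>R x))"
      using x \<open>x \<noteq> 0\<close> by (simp add: blinfun.scaleR_right field_simps)
  qed
qed

section \<open>The plank theorem for matrices\<close>

text \<open>
  Bang's argument: choose the signs that maximise the quadratic form of \<open>H\<close>. Flipping the sign
  of \<open>y k\<close> changes the form by \<open>- 4 * y k * ((H y) k - H k k * y k)\<close>, and this cannot be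
  positive.
\<close>

lemma bang_signs:
  fixes H :: "nat \<Rightarrow> nat \<Rightarrow> real"
  assumes sym: "\<And>i j. i < n \<Longrightarrow> j < n \<Longrightarrow> H i j = H j i"
    and pos: "\<And>i. i < n \<Longrightarrow> \<theta> i > 0"
  obtains y where "\<And>i. i < n \<Longrightarrow> \<bar>y i\<bar> = \<theta> i"
    "\<And>i. i < n \<Longrightarrow> H i i * \<theta> i \<le> \<bar>\<Sum>j<n. H i j * y j\<bar>"
proof -
  define Y where "Y = PiE {..<n} (\<lambda>i. {\<theta> i, - \<theta> i})"
  define E where "E y = (\<Sum>i<n. \<Sum>j<n. y i * H i j * y j)" for y
  have "finite Y" "Y \<noteq> {}" by (auto simp: Y_def PiE_eq_empty_iff intro!: finite_PiE)
  then obtain y where y: "y \<in> Y" and ymax: "\<And>y'. y' \<in> Y \<Longrightarrow> E y' \<le> E y"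
    using obtains_MAX[of Y E] by (metis Max_ge finite_imageI imageI)
  have yabs: "\<bar>y i\<bar> = \<theta> i" if "i < n" for i
    using y pos[OF that] that by (auto simp: Y_def PiE_def Pi_def)
  have "H k k * \<theta> k \<le> \<bar>\<Sum>j<n. H k j * y j\<bar>" if k: "k < n" for k
  proof -
    have "y(k := - y k) \<in> Y" using y k by (auto simp: Y_def PiE_def Pi_def extensional_def)
    then have le: "E (y(k := - y k)) \<le> E y" by (rule ymax)
    define e where "e i = (if i = k then - 2 * y k else 0)" for i
    have upd: "y(k := - y k) = (\<lambda>i. y i + e i)" by (auto simp: e_def)
    have "E (y(k := - y k)) = E y + (\<Sum>i<n. \<Sum>j<n. y i * H i j * e j) + (\<Sum>i<n. \<Sum>j<n. e i * H i j * y j)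
       + (\<Sum>i<n. \<Sum>j<n. e i * H i j * e j)"
      unfolding upd E_def by (simp add: algebra_simps sum.distrib)
    also have "(\<Sum>i<n. \<Sum>j<n. y i * H i j * e j) = (\<Sum>i<n. - 2 * y k * (H k i * y i))"
      using k by (intro sum.cong) (auto simp: e_def if_distrib sym cong: if_cong)
    also have "(\<Sum>i<n. \<Sum>j<n. e i * H i j * y j) = (\<Sum>j<n. \<Sum>i<n. e i * H i j * y j)"
      by (rule sum.swap)
    also have "\<dots> = (\<Sum>i<n. - 2 * y k * (H k i * y i))"
      using k by (intro sum.cong) (auto simp: e_def if_distrib if_distribR cong: if_cong)
    also have "(\<Sum>i<n. \<Sum>j<n. e i * H i j * e j) = 4 * (y k)\<^sup>2 * H k k"
    proof -
      have "(\<Sum>j<n. e i * H i j * e j) = (if i = k then 4 * (y k)\<^sup>2 * H k k else 0)" for i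
      proof -
        have "(\<Sum>j<n. e i * H i j * e j) = (\<Sum>j<n. if j = k then - 2 * y k * (e i * H i k) else 0)"
          by (intro sum.cong) (auto simp: e_def)
        then show ?thesis using k by (simp add: e_def power2_eq_square)
      qed
      then show ?thesis using k by simp
    qed
    also have "(\<Sum>i<n. - 2 * y k * (H k i * y i)) = - 2 * y k * (\<Sum>j<n. H k j * y j)"
      by (simp only: sum_distrib_left)
    finally have "(y k)\<^sup>2 * H k k \<le> y k * (\<Sum>j<n. H k j * y j)"
      using le by linarith
    also have "\<dots> \<le> \<bar>y k\<bar> * \<bar>\<Sum>j<n. H k j * y j\<bar>" by (metis abs_ge_self abs_mult)
    also have "(y k)\<^sup>2 = \<theta> k * \<theta> k" using yabs[OF k] by (metis power2_abs power2_eq_square)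
    finally show ?thesis using pos[OF k] by (simp add: yabs[OF k] mult.assoc mult.commute)
  qed
  with yabs show thesis by (rule that[of y])
qed

definition bilin :: "nat \<Rightarrow> (nat \<Rightarrow> nat \<Rightarrow> real) \<Rightarrow> (nat \<Rightarrow> real) \<Rightarrow> (nat \<Rightarrow> real) \<Rightarrow> real"
  where "bilin n V a b = (\<Sum>i<n. \<Sum>j<n. a i * V i j * b j)"

definition sqnorm :: "nat \<Rightarrow> (nat \<Rightarrow> real) \<Rightarrow> real"
  where "sqnorm n a = (\<Sum>i<n. (a i)\<^sup>2)"

text \<open>
  The operator norm of the leading \<open>n \<times> n\<close> block of \<open>V\<close> is at most \<open>r\<close>. In this form, equivalent
  to \<open>bilin n V a b \<le> r * sqrt (sqnorm n a) * sqrt (sqnorm n b)\<close> by scaling \<open>a\<close> against \<open>b\<close>, the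
  condition is linear in \<open>V\<close> for fixed \<open>a\<close> and \<open>b\<close>, so that it visibly defines a closed convex
  set, and perturbations of \<open>V\<close> can be checked by expanding squares.
\<close>

definition norm_le_matrix :: "nat \<Rightarrow> real \<Rightarrow> (nat \<Rightarrow> nat \<Rightarrow> real) \<Rightarrow> bool"
  where "norm_le_matrix n r V \<longleftrightarrow> (\<forall>a b. 2 * bilin n V a b \<le> r * (sqnorm n a + sqnorm n b))"

lemma sqnorm_ge_coordinate: "k < n \<Longrightarrow> (a k)\<^sup>2 \<le> sqnorm n a"
  unfolding sqnorm_def using member_le_sum[of k "{..<n}" "\<lambda>i. (a i)\<^sup>2"] by simp

lemma sqnorm_single:
  assumes "k < n"
  shows "sqnorm n (\<lambda>i. if i = k then s else 0) = s\<^sup>2"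
proof -
  have "sqnorm n (\<lambda>i. if i = k then s else 0) = (\<Sum>i<n. if i = k then s\<^sup>2 else 0)"
    unfolding sqnorm_def by (intro sum.cong) auto
  then show ?thesis using assms by simp
qed

lemma norm_le_matrix_entry:
  assumes "norm_le_matrix n r V" "k < n" "l < n"
  shows "\<bar>V k l\<bar> \<le> r"
proof -
  have "2 * (s * V k l) \<le> r * (1 + s\<^sup>2)" for s
  proof -
    have "bilin n V (\<lambda>i. if i = k then 1 else 0) (\<lambda>j. if j = l then s else 0) = s * V k l"
    proof -
      have "(\<Sum>j<n. (if i = k then 1 else 0) * V i j * (if j = l then s else 0)) =
          (if i = k then s * V k l else 0)" for i
      proof -
        have "(\<Sum>j<n. (if i = k then 1 else 0) * V i j * (if j = l then s else 0)) =
            (\<Sum>j<n. if j = l then (if i = k then s * V k l else 0) else 0)"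
          by (intro sum.cong) auto
        then show ?thesis using assms(3) by simp
      qed
      then show ?thesis using assms(2) by (simp add: bilin_def)
    qed
    moreover have "sqnorm n (\<lambda>i. if i = k then 1 else 0) = 1" "sqnorm n (\<lambda>j. if j = l then s else 0) = s\<^sup>2"
      using sqnorm_single[OF assms(2), of 1] sqnorm_single[OF assms(3), of s] by simp_all
    ultimately show ?thesis using assms(1) unfolding norm_le_matrix_def by metis
  qed
  from this[of 1] this[of "-1"] show ?thesis by simp
qed

text \<open>
  Test the bilinear form with \<open>a = V y\<close> and \<open>b = y\<close>.
\<close>

lemma norm_le_matrix_apply:
  assumes "norm_le_matrix n 1 V"
  shows "sqnorm n (\<lambda>k. \<Sum>j<n. V k j * y j) \<le> sqnorm n y"
proof -
  define m where "m k = (\<Sum>j<n. V k j * y j)" for k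
  have "bilin n V m y = sqnorm n m"
    by (simp add: m_def bilin_def sqnorm_def power2_eq_square sum_distrib_left mult.assoc)
  moreover have "2 * bilin n V m y \<le> 1 * (sqnorm n m + sqnorm n y)"
    using assms unfolding norm_le_matrix_def by blast
  ultimately have "sqnorm n m \<le> sqnorm n y" by simp
  then show ?thesis by (simp add: m_def[abs_def])
qed

text \<open>
  The contractions form a compact convex set in the product topology, so the product of the
  \<open>d i V powr w i\<close> attains its maximum over those with all \<open>d i V \<ge> 0\<close>; at the identity it is
  positive. The logarithm of the product is concave and \<open>d i\<close> is linear, so comparing \<open>V\<close> with
  \<open>(1 - t) V + t W\<close> for small \<open>t\<close> yields the inequality for \<open>W\<close>: the derivative of the logarithm
  at \<open>V\<close> in the direction of \<open>W - V\<close> is not positive.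
\<close>

lemma log_product_maximiser:
  fixes n :: nat and B :: "nat \<Rightarrow> nat \<Rightarrow> real" and w :: "nat \<Rightarrow> real"
  defines "d \<equiv> \<lambda>i V. \<Sum>k<n. B i k * V k i"
  assumes diag: "\<And>i. i < n \<Longrightarrow> B i i > 0" and w: "\<And>i. i < n \<Longrightarrow> w i > 0"
  obtains V where "norm_le_matrix n 1 V" "\<And>i. i < n \<Longrightarrow> d i V > 0"
    "\<And>W r. norm_le_matrix n r W \<Longrightarrow> r > 0 \<Longrightarrow> (\<Sum>i<n. w i / d i V * d i W) \<le> r * (\<Sum>i<n. w i)"
proof -
  define K where "K = {V. (\<forall>i j. V i j \<in> {-1..1}) \<and> norm_le_matrix n 1 V \<and> (\<forall>i<n. 0 \<le> d i V)}"
  define F where "F V = (\<Prod>i<n. d i V powr w i)" for V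
  have cont_entry: "continuous_on S (\<lambda>V. V i j)" for S :: "(nat \<Rightarrow> nat \<Rightarrow> real) set" and i j
    using continuous_on_product_then_coordinatewise continuous_on_product_coordinates
      continuous_on_subset by (metis subset_UNIV)
  have cont_d: "continuous_on S (d i)" for S i
    unfolding d_def by (intro continuous_intros cont_entry)
  have d_trunc: "d i (\<lambda>i j. if i < n \<and> j < n then W i j else 0) = d i W" if "i < n" for i W
    using that by (simp add: d_def)
  have trunc: "norm_le_matrix n r (\<lambda>i j. if i < n \<and> j < n then W i j else 0) = norm_le_matrix n r W" for r W
    by (simp add: norm_le_matrix_def bilin_def)
  have K_I: "(\<lambda>i j. if i < n \<and> j < n then W i j else 0) \<in> K"
    if "norm_le_matrix n 1 W" "\<And>i. i < n \<Longrightarrow> 0 \<le> d i W" for W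
  proof -
    have "\<bar>if i < n \<and> j < n then W i j else 0\<bar> \<le> 1" for i j
      using norm_le_matrix_entry[OF that(1)] by auto
    then show ?thesis unfolding K_def using that d_trunc trunc
      by (auto simp: abs_le_iff minus_le_iff)
  qed
  have "compact K"
  proof -
    have "compact {V :: nat \<Rightarrow> nat \<Rightarrow> real. \<forall>i. V i \<in> {f. \<forall>j. f j \<in> {-1..1}}}"
      by (intro compact_product_set) auto
    moreover have "closed {V :: nat \<Rightarrow> nat \<Rightarrow> real. norm_le_matrix n 1 V \<and> (\<forall>i<n. 0 \<le> d i V)}"
      unfolding norm_le_matrix_def bilin_def
      by (intro closed_Collect_conj closed_Collect_all closed_Collect_imp closed_Collect_le
            continuous_intros cont_entry cont_d) auto
    ultimately have "compact ({V :: nat \<Rightarrow> nat \<Rightarrow> real. \<forall>i. V i \<in> {f. \<forall>j. f j \<in> {-1..1}}} \<inter>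
        {V. norm_le_matrix n 1 V \<and> (\<forall>i<n. 0 \<le> d i V)})" by (rule compact_Int_closed)
    also have "\<dots> = K" by (auto simp: K_def)
    finally show ?thesis .
  qed
  let ?I = "\<lambda>i j :: nat. if i = j then 1 else 0 :: real"
  have I: "norm_le_matrix n 1 ?I"
  proof -
    have le: "2 * (\<Sum>i<n. a i * b i) \<le> sqnorm n a + sqnorm n b" for a b :: "nat \<Rightarrow> real"
    proof -
      have "2 * (\<Sum>i<n. a i * b i) = (\<Sum>i<n. 2 * a i * b i)"
        by (simp add: sum_distrib_left mult.assoc)
      also have "\<dots> \<le> (\<Sum>i<n. (a i)\<^sup>2 + (b i)\<^sup>2)" by (intro sum_mono sum_squares_bound)
      finally show ?thesis by (simp add: sqnorm_def sum.distrib)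
    qed
    have "bilin n ?I a b = (\<Sum>i<n. a i * b i)" for a b
    proof -
      have "(\<Sum>j<n. a i * ?I i j * b j) = a i * b i" if "i < n" for i
      proof -
        have "(\<Sum>j<n. a i * ?I i j * b j) = (\<Sum>j<n. if i = j then a i * b i else 0)"
          by (intro sum.cong) auto
        then show ?thesis using that by simp
      qed
      then show ?thesis by (simp add: bilin_def)
    qed
    with le show ?thesis by (simp add: norm_le_matrix_def)
  qed
  have dI: "d i ?I = B i i" if "i < n" for i
  proof -
    have "d i ?I = (\<Sum>k<n. if k = i then B i i else 0)"
      unfolding d_def by (intro sum.cong) auto
    then show ?thesis using that by simp
  qed
  define J where "J = (\<lambda>i j. if i < n \<and> j < n then ?I i j else 0)"
  have JK: "J \<in> K" unfolding J_def using dI diag by (intro K_I I) (simp add: less_imp_le)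
  have "continuous_on K F"
    unfolding F_def using w by (intro continuous_on_prod continuous_on_powr' cont_d continuous_intros) (auto simp: K_def)
  then obtain V where VK: "V \<in> K" and Vmax: "\<And>W. W \<in> K \<Longrightarrow> F W \<le> F V"
    using continuous_attains_sup[OF \<open>compact K\<close>] JK by blast
  have V1: "norm_le_matrix n 1 V" and dge: "\<And>i. i < n \<Longrightarrow> 0 \<le> d i V"
    using VK by (auto simp: K_def)
  have "F J > 0" unfolding F_def J_def using dI diag d_trunc
    by (intro prod_pos) (simp add: less_imp_neq[symmetric])
  with Vmax[OF JK] have FV: "F V > 0" by simp
  have dpos: "d i V > 0" if "i < n" for i
  proof -
    have "(\<Prod>i<n. d i V powr w i) \<noteq> 0" using FV unfolding F_def by (rule less_imp_neq[symmetric])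
    then have "d i V \<noteq> 0" using that by (auto simp: prod_zero_iff)
    with dge[OF that] show ?thesis by simp
  qed
  have first_order: "(\<Sum>i<n. w i / d i V * d i W) \<le> (\<Sum>i<n. w i)" if W: "norm_le_matrix n 1 W" for W
  proof -
    define u where "u i = d i W / d i V - 1" for i
    define U where "U = (\<Sum>i<n. \<bar>u i\<bar>)"
    \<comment> \<open>For \<open>t < \<delta>\<close> every \<open>t * u i\<close> lies in \<open>{-1/2..1/2}\<close>, where \<open>ln (1 + x) \<ge> x - 2 * x\<^sup>2\<close>.\<close>
    define \<delta> where "\<delta> = 1 / (2 * (1 + U))"
    have s: "0 \<le> U" by (simp add: U_def sum_nonneg)
    then have \<delta>: "0 < \<delta>" "\<delta> \<le> 1/2" by (auto simp: \<delta>_def field_simps)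
    have "(\<Sum>i<n. w i * u i) \<le> t * (\<Sum>i<n. w i * (2 * (u i)\<^sup>2))" if t: "0 < t" "t < \<delta>" for t
    proof -
      have small: "\<bar>t * u i\<bar> \<le> 1/2" if "i < n" for i
      proof -
        have "\<bar>u i\<bar> \<le> U" unfolding U_def using that member_le_sum[of i "{..<n}" "\<lambda>i. \<bar>u i\<bar>"] by simp
        then have "t * \<bar>u i\<bar> \<le> \<delta> * (1 + U)" using t by (intro mult_mono) auto
        also have "\<dots> = 1/2" using s by (simp add: \<delta>_def field_simps)
        finally show ?thesis using t by (simp add: abs_mult)
      qed
      define Z where "Z i j = (1 - t) * V i j + t * W i j" for i j
      have dZ: "d i Z = d i V * (1 + t * u i)" if "i < n" for i
      proof -
        have "d i Z = (1 - t) * d i V + t * d i W"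
          by (simp add: d_def Z_def sum_distrib_left sum.distrib algebra_simps sum_subtractf)
        also have "\<dots> = d i V + t * (d i V * u i)"
        proof -
          have "d i V * u i = d i W - d i V" using dpos[OF that] by (simp add: u_def field_simps)
          then show ?thesis unfolding \<open>d i V * u i = d i W - d i V\<close> by (simp add: algebra_simps)
        qed
        finally show ?thesis by (simp add: algebra_simps)
      qed
      have one: "1 + t * u i > 0" if "i < n" for i using small[OF that] by linarith
      have "norm_le_matrix n 1 Z" unfolding norm_le_matrix_def
      proof (intro allI)
        fix a b
        have "2 * bilin n Z a b = (1 - t) * (2 * bilin n V a b) + t * (2 * bilin n W a b)"
          by (simp add: bilin_def Z_def sum_distrib_left sum.distrib algebra_simps sum_subtractf)
        also have "\<dots> \<le> (1 - t) * (1 * (sqnorm n a + sqnorm n b)) + t * (1 * (sqnorm n a + sqnorm n b))"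
          using V1 W t \<delta> unfolding norm_le_matrix_def by (intro add_mono mult_left_mono) auto
        finally show "2 * bilin n Z a b \<le> 1 * (sqnorm n a + sqnorm n b)" by (simp add: algebra_simps)
      qed
      then have "(\<lambda>i j. if i < n \<and> j < n then Z i j else 0) \<in> K"
        using dZ dpos one by (intro K_I) (simp_all add: less_imp_le)
      from Vmax[OF this] have "F Z \<le> F V" by (simp add: F_def d_trunc)
      moreover have "F Z = F V * (\<Prod>i<n. (1 + t * u i) powr w i)"
        using dpos one by (simp add: F_def dZ powr_mult less_imp_le prod.distrib[symmetric])
      ultimately have "(\<Prod>i<n. (1 + t * u i) powr w i) \<le> 1" using FV by simp
      moreover have "(\<Prod>i<n. (1 + t * u i) powr w i) = exp (\<Sum>i<n. w i * ln (1 + t * u i))"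
        using one by (simp add: exp_sum powr_def less_imp_neq[symmetric])
      ultimately have ln0: "(\<Sum>i<n. w i * ln (1 + t * u i)) \<le> 0" by simp
      have "(\<Sum>i<n. w i * (t * u i - 2 * (t * u i)\<^sup>2)) \<le> (\<Sum>i<n. w i * ln (1 + t * u i))"
      proof (intro sum_mono mult_left_mono)
        fix i assume "i \<in> {..<n}"
        then show "t * u i - 2 * (t * u i)\<^sup>2 \<le> ln (1 + t * u i)" "0 \<le> w i"
          using abs_ln_one_plus_x_minus_x_bound[OF small[of i]] w[of i] by auto
      qed
      also note ln0
      also have "(\<Sum>i<n. w i * (t * u i - 2 * (t * u i)\<^sup>2)) =
          t * ((\<Sum>i<n. w i * u i) - t * (\<Sum>i<n. w i * (2 * (u i)\<^sup>2)))"
        by (simp add: sum_distrib_left sum_subtractf algebra_simps power2_eq_square)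
      finally show ?thesis using t by (simp add: mult_le_0_iff)
    qed
    then have "(\<Sum>i<n. w i * u i) \<le> 0" by (rule nonpos_if_le_small_multiples[OF \<delta>(1)])
    moreover have "(\<Sum>i<n. w i * u i) = (\<Sum>i<n. w i / d i V * d i W) - (\<Sum>i<n. w i)"
      by (simp add: u_def algebra_simps sum_subtractf)
    ultimately show ?thesis by simp
  qed
  show thesis
  proof
    fix W r assume W: "norm_le_matrix n r W" and r: "r > (0::real)"
    have "norm_le_matrix n 1 (\<lambda>i j. (1/r) * W i j)"
      unfolding norm_le_matrix_def
    proof (intro allI)
      fix a b
      have "2 * bilin n (\<lambda>i j. (1/r) * W i j) a b = (1/r) * (2 * bilin n W a b)"
        by (simp add: bilin_def sum_distrib_left algebra_simps)
      also have "\<dots> \<le> (1/r) * (r * (sqnorm n a + sqnorm n b))"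
        using W r unfolding norm_le_matrix_def by (intro mult_left_mono) auto
      finally show "2 * bilin n (\<lambda>i j. (1/r) * W i j) a b \<le> 1 * (sqnorm n a + sqnorm n b)"
        using r by simp
    qed
    from first_order[OF this] have "(1/r) * (\<Sum>i<n. w i / d i V * d i W) \<le> (\<Sum>i<n. w i)"
      by (simp add: d_def sum_distrib_left algebra_simps)
    then show "(\<Sum>i<n. w i / d i V * d i W) \<le> r * (\<Sum>i<n. w i)"
      using r by (simp add: field_simps)
  qed (use V1 dpos in auto)
qed

text \<open>
  Ball's theorem. For the maximiser \<open>V\<close> of \<open>log_product_maximiser\<close>, applied to the matrix \<open>A\<close>
  with its columns scaled by \<open>sqrt (w k)\<close>, let \<open>P\<close> be that matrix with row \<open>i\<close> scaled by
  \<open>\<theta> i = w i / d i V\<close>. Then \<open>H = P V\<close> has diagonal \<open>w\<close>, and \<open>V\<close> maximises the trace of \<open>P W\<close>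
  among contractions \<open>W\<close>. Two perturbations of \<open>V\<close> exploit this. Rotating two coordinates shows
  that \<open>H\<close> is symmetric. Decreasing \<open>V\<close> along the \<open>k\<close>-th row and column while increasing its
  \<open>k\<close>-th diagonal entry gives the Cauchy-Schwarz type inequality
  \<open>(P k k)\<^sup>2 \<le> (P V) k k * (V P) k k\<close>, which reads \<open>(\<theta> k)\<^sup>2 \<le> (V P) k k\<close>; summing over \<open>k\<close>, the
  squares of the \<open>\<theta> k\<close> add up to at most the trace of \<open>V P\<close>, which is the sum of \<open>w\<close>. Bang's
  signs \<open>y\<close> for \<open>H\<close> with moduli \<open>\<theta>\<close> then give \<open>\<mu> = V y\<close>.
\<close>

theorem ball_matrix:
  fixes n :: nat and A :: "nat \<Rightarrow> nat \<Rightarrow> real" and w :: "nat \<Rightarrow> real"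
  assumes diag: "\<And>i. i < n \<Longrightarrow> A i i = 1" and w: "\<And>i. i < n \<Longrightarrow> w i > 0"
    and sum_w: "(\<Sum>i<n. w i) \<le> 1"
  obtains \<mu> where "(\<Sum>k<n. (\<mu> k)\<^sup>2) \<le> 1"
    "\<And>i. i < n \<Longrightarrow> w i \<le> \<bar>\<Sum>k<n. sqrt (w k) * \<mu> k * A i k\<bar>"
proof -
  define d where "d i V = (\<Sum>k<n. A i k * sqrt (w k) * V k i)" for i and V :: "nat \<Rightarrow> nat \<Rightarrow> real"
  have "A i i * sqrt (w i) > 0" if "i < n" for i using that diag w by simp
  then obtain V where V: "norm_le_matrix n 1 V" and dpos: "\<And>i. i < n \<Longrightarrow> d i V > 0"
    and opt: "\<And>W r. norm_le_matrix n r W \<Longrightarrow> r > 0 \<Longrightarrow>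
       (\<Sum>i<n. w i / d i V * d i W) \<le> r * (\<Sum>i<n. w i)"
    using log_product_maximiser[of n "\<lambda>i k. A i k * sqrt (w k)" w] w unfolding d_def by blast
  define \<theta> where "\<theta> i = w i / d i V" for i
  have \<theta>: "\<theta> i > 0" if "i < n" for i using that w dpos by (simp add: \<theta>_def)
  define P where "P i k = \<theta> i * A i k * sqrt (w k)" for i k
  define H where "H i j = (\<Sum>k<n. P i k * V k j)" for i j
  define \<sigma> where "\<sigma> = (\<Sum>i<n. w i)"
  define tr where "tr W = (\<Sum>i<n. \<Sum>k<n. P i k * W k i)" for W :: "nat \<Rightarrow> nat \<Rightarrow> real"
  have tr: "tr W \<le> r * \<sigma>" if "norm_le_matrix n r W" "r > 0" for r W
    using opt[OF that] by (simp add: tr_def \<sigma>_def P_def \<theta>_def d_def sum_distrib_left mult.assoc)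
  have H_diag: "H i i = w i" if "i < n" for i
  proof -
    have "H i i = \<theta> i * d i V" by (simp add: H_def P_def d_def sum_distrib_left mult.assoc)
    then show ?thesis using dpos[OF that] by (simp add: \<theta>_def)
  qed
  have trV: "tr V = \<sigma>"
    using H_diag by (simp add: tr_def \<sigma>_def H_def)
  have norm_V: "2 * bilin n V a b \<le> sqnorm n a + sqnorm n b" for a b
    using V unfolding norm_le_matrix_def by (metis mult_1)
  have H_le: "H l k \<le> H k l" if k: "k < n" and l: "l < n" and kl: "k \<noteq> l" for k l
  proof -
    have "H l k - H k l \<le> s * \<sigma>" if s: "0 < s" for s
    proof -
      \<comment> \<open>To first order in \<open>s\<close> this is \<open>V\<close> multiplied by a rotation in the plane of the coordinates \<open>k\<close> and \<open>l\<close>.\<close>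
      define W where "W i j = V i j + s * ((if j = l then V i k else 0) - (if j = k then V i l else 0))" for i j
      have "norm_le_matrix n (1 + s\<^sup>2) W"
        unfolding norm_le_matrix_def
      proof (intro allI)
        fix a b :: "nat \<Rightarrow> real"
        define x where "x j = (if j = k then b l else 0) - (if j = l then b k else 0)" for j
        have row: "(\<Sum>j<n. a i * W i j * b j) = (\<Sum>j<n. a i * V i j * (b j + s * x j))" for i
        proof -
          have "(\<Sum>j<n. a i * W i j * b j) = (\<Sum>j<n. a i * V i j * b j)
              + s * ((\<Sum>j<n. if j = l then a i * V i k * b l else 0) - (\<Sum>j<n. if j = k then a i * V i l * b k else 0))"
            unfolding sum_subtractf[symmetric] sum_distrib_left sum.distrib[symmetric]
            by (intro sum.cong) (auto simp: W_def algebra_simps)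
          also have "(\<Sum>j<n. if j = l then a i * V i k * b l else 0) = (\<Sum>j<n. if j = k then a i * V i k * b l else 0)"
            using k l by simp
          also have "(\<Sum>j<n. if j = k then a i * V i l * b k else 0) = (\<Sum>j<n. if j = l then a i * V i l * b k else 0)"
            using k l by simp
          also have "(\<Sum>j<n. a i * V i j * b j) + s * ((\<Sum>j<n. if j = k then a i * V i k * b l else 0)
              - (\<Sum>j<n. if j = l then a i * V i l * b k else 0)) = (\<Sum>j<n. a i * V i j * (b j + s * x j))"
            unfolding sum_subtractf[symmetric] sum_distrib_left sum.distrib[symmetric]
            by (intro sum.cong) (auto simp: x_def algebra_simps)
          finally show ?thesis .
        qed
        have "(\<Sum>j<n. b j * x j) = (\<Sum>j<n. (if j = k then b k * b l else 0) - (if j = l then b l * b k else 0))"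
          by (intro sum.cong) (auto simp: x_def)
        then have orth: "(\<Sum>j<n. b j * x j) = 0" using k l by (simp add: sum_subtractf)
        have "(\<Sum>j<n. (x j)\<^sup>2) = (\<Sum>j<n. (if j = k then (b l)\<^sup>2 else 0) + (if j = l then (b k)\<^sup>2 else 0))"
          using kl by (intro sum.cong) (auto simp: x_def)
        also have "\<dots> = (\<Sum>j<n. (if j = k then (b k)\<^sup>2 else 0) + (if j = l then (b l)\<^sup>2 else 0))"
          using k l by (simp add: sum.distrib)
        also have "\<dots> \<le> sqnorm n b"
          unfolding sqnorm_def using kl by (intro sum_mono) auto
        finally have x_le: "(\<Sum>j<n. (x j)\<^sup>2) \<le> sqnorm n b" .
        have "sqnorm n (\<lambda>j. b j + s * x j) = sqnorm n b + 2 * s * (\<Sum>j<n. b j * x j) + s\<^sup>2 * (\<Sum>j<n. (x j)\<^sup>2)"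
          unfolding sqnorm_def sum_distrib_left sum.distrib[symmetric]
          by (intro sum.cong) (auto simp: power2_eq_square algebra_simps)
        also have "\<dots> \<le> sqnorm n b + s\<^sup>2 * sqnorm n b"
          using orth mult_left_mono[OF x_le, of "s\<^sup>2"] by simp
        finally have nb: "sqnorm n (\<lambda>j. b j + s * x j) \<le> sqnorm n b + s\<^sup>2 * sqnorm n b" .
        have "bilin n W a b = bilin n V a (\<lambda>j. b j + s * x j)"
          by (simp only: bilin_def row)
        then have "2 * bilin n W a b \<le> sqnorm n a + (sqnorm n b + s\<^sup>2 * sqnorm n b)"
          using norm_V[of a "\<lambda>j. b j + s * x j"] nb by simp
        also have "\<dots> \<le> (1 + s\<^sup>2) * (sqnorm n a + sqnorm n b)"
          by (simp add: algebra_simps sqnorm_def sum_nonneg)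
        finally show "2 * bilin n W a b \<le> (1 + s\<^sup>2) * (sqnorm n a + sqnorm n b)" .
      qed
      then have "tr W \<le> (1 + s\<^sup>2) * \<sigma>" by (rule tr) (simp add: add_pos_nonneg)
      moreover have "tr W = tr V + s * ((\<Sum>i<n. if i = l then H l k else 0) - (\<Sum>i<n. if i = k then H k l else 0))"
        unfolding tr_def sum_subtractf[symmetric] sum_distrib_left sum.distrib[symmetric]
        by (intro sum.cong) (auto simp: W_def H_def algebra_simps sum_subtractf sum.distrib sum_distrib_left)
      ultimately have "s * (H l k - H k l) \<le> s * (s * \<sigma>)"
        using k l trV by (simp add: algebra_simps power2_eq_square)
      then show ?thesis using s by simp
    qed
    then have "H l k - H k l \<le> 0" using nonpos_if_le_small_multiples[of 1 "H l k - H k l" \<sigma>] by auto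
    then show ?thesis by simp
  qed
  have H_sym: "H i j = H j i" if "i < n" "j < n" for i j
    using H_le[of i j] H_le[of j i] that by (cases "i = j") auto
  define q where "q k = (\<Sum>i<n. V k i * P i k)" for k
  have \<theta>_le: "(\<theta> k)\<^sup>2 \<le> q k" if k: "k < n" for k
  proof -
    \<comment> \<open>This \<open>x\<close> minimises \<open>x\<^sup>2 * H k k - 2 * x * P k k\<close>; the minimum is \<open>- (\<theta> k)\<^sup>2\<close>.\<close>
    define x where "x = \<theta> k / sqrt (w k)"
    have x: "x * P k k = (\<theta> k)\<^sup>2" "x\<^sup>2 * w k = (\<theta> k)\<^sup>2"
      using w[OF k] diag[OF k] by (simp_all add: x_def P_def power2_eq_square field_simps)
    define C where "C = (1 + x ^ 4) * \<sigma> - x\<^sup>2 * P k k * V k k"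
    have "(\<theta> k)\<^sup>2 - q k \<le> s * C" if s: "0 < s" for s
    proof -
      \<comment> \<open>Scaling row \<open>k\<close> and column \<open>k\<close> down makes room, to first order in \<open>s\<close>, for the new entry:
        in the bound for \<open>W\<close> the first-order terms combine to \<open>- 2 * s * (a k - x * b k)\<^sup>2\<close>.\<close>
      define W where "W i j = (1 - (if i = k then s else 0)) * (1 - (if j = k then s * x\<^sup>2 else 0)) * V i j
        + (if j = k then if i = k then 2 * s * x else 0 else 0)" for i j
      have "norm_le_matrix n (1 + s\<^sup>2 * (1 + x ^ 4)) W"
        unfolding norm_le_matrix_def
      proof (intro allI)
        fix a b :: "nat \<Rightarrow> real"
        define a' where "a' i = a i * (1 - (if i = k then s else 0))" for i
        define b' where "b' j = b j * (1 - (if j = k then s * x\<^sup>2 else 0))" for j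
        have row: "(\<Sum>j<n. a i * W i j * b j) = (\<Sum>j<n. a' i * V i j * b' j) + (if i = k then 2 * s * x * a k * b k else 0)" for i
        proof -
          have "(\<Sum>j<n. a i * W i j * b j) = (\<Sum>j<n. a' i * V i j * b' j)
              + (\<Sum>j<n. if j = k then if i = k then 2 * s * x * a k * b k else 0 else 0)"
            unfolding sum.distrib[symmetric]
            by (intro sum.cong) (auto simp: W_def a'_def b'_def algebra_simps)
          then show ?thesis using k by simp
        qed
        have bil: "bilin n W a b = bilin n V a' b' + 2 * s * x * a k * b k"
          using k by (simp add: bilin_def row sum.distrib)
        have na: "sqnorm n a' = sqnorm n a - (2 * s - s\<^sup>2) * (a k)\<^sup>2"
        proof -
          have "sqnorm n a' = sqnorm n a - (\<Sum>i<n. if i = k then (2 * s - s\<^sup>2) * (a k)\<^sup>2 else 0)"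
            unfolding sqnorm_def sum_subtractf[symmetric]
            by (intro sum.cong) (auto simp: a'_def algebra_simps power2_eq_square)
          then show ?thesis using k by simp
        qed
        have nb: "sqnorm n b' = sqnorm n b - (2 * s * x\<^sup>2 - s\<^sup>2 * x ^ 4) * (b k)\<^sup>2"
        proof -
          have "sqnorm n b' = sqnorm n b - (\<Sum>i<n. if i = k then (2 * s * x\<^sup>2 - s\<^sup>2 * x ^ 4) * (b k)\<^sup>2 else 0)"
            unfolding sqnorm_def sum_subtractf[symmetric]
            by (intro sum.cong) (auto simp: b'_def algebra_simps power2_eq_square power4_eq_xxxx)
          then show ?thesis using k by simp
        qed
        have "2 * bilin n W a b \<le> sqnorm n a' + sqnorm n b' + 4 * s * x * a k * b k"
          using norm_V[of a' b'] by (simp add: bil)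
        also have "\<dots> = sqnorm n a + sqnorm n b - 2 * s * (a k - x * b k)\<^sup>2 + s\<^sup>2 * ((a k)\<^sup>2 + x ^ 4 * (b k)\<^sup>2)"
          by (simp add: na nb algebra_simps power2_eq_square power4_eq_xxxx)
        also have "\<dots> \<le> sqnorm n a + sqnorm n b + s\<^sup>2 * ((1 + x ^ 4) * (sqnorm n a + sqnorm n b))"
        proof -
          have "(a k)\<^sup>2 \<le> sqnorm n a" "(b k)\<^sup>2 \<le> sqnorm n b"
            using sqnorm_ge_coordinate[OF k] by auto
          moreover from this have "0 \<le> sqnorm n a" "0 \<le> sqnorm n b"
            by (meson order_trans zero_le_power2)+
          moreover have "x ^ 4 * (b k)\<^sup>2 \<le> x ^ 4 * sqnorm n b" using sqnorm_ge_coordinate[OF k] by (intro mult_left_mono) auto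
          ultimately have "(a k)\<^sup>2 + x ^ 4 * (b k)\<^sup>2 \<le> sqnorm n a + x ^ 4 * sqnorm n b"
            "0 \<le> x ^ 4 * sqnorm n a" "0 \<le> sqnorm n b"
            using sqnorm_ge_coordinate[OF k, of a] by auto
          then have "(a k)\<^sup>2 + x ^ 4 * (b k)\<^sup>2 \<le> (1 + x ^ 4) * (sqnorm n a + sqnorm n b)"
            unfolding distrib_right distrib_left mult_1 by linarith
          then have "s\<^sup>2 * ((a k)\<^sup>2 + x ^ 4 * (b k)\<^sup>2) \<le> s\<^sup>2 * ((1 + x ^ 4) * (sqnorm n a + sqnorm n b))"
            by (rule mult_left_mono) simp
          moreover have "0 \<le> 2 * s * (a k - x * b k)\<^sup>2" using s by simp
          ultimately show ?thesis by linarith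
        qed
        finally show "2 * bilin n W a b \<le> (1 + s\<^sup>2 * (1 + x ^ 4)) * (sqnorm n a + sqnorm n b)"
          by (simp add: algebra_simps)
      qed
      then have "tr W \<le> (1 + s\<^sup>2 * (1 + x ^ 4)) * \<sigma>" by (rule tr) (simp add: add_pos_nonneg)
      moreover have "tr W = tr V - s * q k - s * (x\<^sup>2 * w k) + s\<^sup>2 * x\<^sup>2 * P k k * V k k + 2 * s * (x * P k k)"
      proof -
        have inner: "(\<Sum>m<n. P i m * W m i) = (\<Sum>m<n. P i m * V m i) - s * (V k i * P i k)
            + (if i = k then - s * (x\<^sup>2 * w k) + s\<^sup>2 * x\<^sup>2 * P k k * V k k + 2 * s * (x * P k k) else 0)"
          if i: "i < n" for i
        proof (cases "i = k")
          case True
          have "(\<Sum>m<n. P k m * W m k) = (\<Sum>m<n. (1 - s * x\<^sup>2) * (P k m * V m k)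
              + (if m = k then - s * (1 - s * x\<^sup>2) * (P k k * V k k) + 2 * s * x * P k k else 0))"
            by (intro sum.cong) (auto simp: W_def algebra_simps)
          also have "\<dots> = (1 - s * x\<^sup>2) * H k k - s * (1 - s * x\<^sup>2) * (P k k * V k k) + 2 * s * x * P k k"
            using k by (simp add: sum.distrib H_def flip: sum_distrib_left)
          also have "\<dots> = H k k - s * (V k k * P k k)
              + (- s * (x\<^sup>2 * w k) + s\<^sup>2 * x\<^sup>2 * P k k * V k k + 2 * s * (x * P k k))"
            by (simp add: H_diag[OF k] algebra_simps power2_eq_square)
          finally show ?thesis using True by (simp add: H_def)
        next
          case False
          have "(\<Sum>m<n. P i m * W m i) = (\<Sum>m<n. P i m * V m i + (if m = k then - s * (V k i * P i k) else 0))"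
            using False by (intro sum.cong) (auto simp: W_def algebra_simps)
          then show ?thesis using k False by (simp add: sum.distrib)
        qed
        have "tr W = (\<Sum>i<n. (\<Sum>m<n. P i m * V m i) - s * (V k i * P i k)
            + (if i = k then - s * (x\<^sup>2 * w k) + s\<^sup>2 * x\<^sup>2 * P k k * V k k + 2 * s * (x * P k k) else 0))"
          unfolding tr_def by (intro sum.cong) (simp_all add: inner)
        also have "\<dots> = tr V - s * q k + (- s * (x\<^sup>2 * w k) + s\<^sup>2 * x\<^sup>2 * P k k * V k k + 2 * s * (x * P k k))"
          using k by (simp add: tr_def q_def sum.distrib sum_subtractf sum_distrib_left)
        finally show ?thesis by simp
      qed
      ultimately have "s * ((\<theta> k)\<^sup>2 - q k) \<le> s * (s * C)"
        unfolding x C_def trV by (simp add: algebra_simps power2_eq_square)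
      then show ?thesis using s by simp
    qed
    then have "(\<theta> k)\<^sup>2 - q k \<le> 0" using nonpos_if_le_small_multiples[of 1 "(\<theta> k)\<^sup>2 - q k" C] by auto
    then show ?thesis by simp
  qed
  have "(\<Sum>k<n. q k) = tr V"
    unfolding q_def tr_def by (subst sum.swap) (simp add: mult.commute)
  then have \<theta>_sum: "sqnorm n \<theta> \<le> 1"
    using sum_mono[of "{..<n}" "\<lambda>k. (\<theta> k)\<^sup>2" q] \<theta>_le sum_w trV by (auto simp: sqnorm_def \<sigma>_def)
  obtain y where y: "\<And>i. i < n \<Longrightarrow> \<bar>y i\<bar> = \<theta> i"
    and Hy: "\<And>i. i < n \<Longrightarrow> H i i * \<theta> i \<le> \<bar>\<Sum>j<n. H i j * y j\<bar>"
    using bang_signs[of n H \<theta>] H_sym \<theta> by blast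
  show thesis
  proof (rule that)
    have "(y i)\<^sup>2 = (\<theta> i)\<^sup>2" if "i < n" for i
      using y[OF that] by (metis power2_abs)
    then have "sqnorm n y = sqnorm n \<theta>"
      by (simp add: sqnorm_def)
    then show "(\<Sum>k<n. (\<Sum>j<n. V k j * y j)\<^sup>2) \<le> 1"
      using norm_le_matrix_apply[OF V, of y] \<theta>_sum by (simp add: sqnorm_def)
    fix i assume i: "i < n"
    define t where "t = (\<Sum>k<n. sqrt (w k) * (\<Sum>j<n. V k j * y j) * A i k)"
    have "\<theta> i * t = (\<Sum>k<n. \<Sum>j<n. P i k * V k j * y j)"
      unfolding t_def P_def sum_distrib_left sum_distrib_right
      by (intro sum.cong refl) (simp add: algebra_simps)
    also have "\<dots> = (\<Sum>j<n. H i j * y j)"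
      unfolding H_def sum_distrib_right by (rule sum.swap)
    finally have "\<bar>\<Sum>j<n. H i j * y j\<bar> = \<theta> i * \<bar>t\<bar>"
      using \<theta>[OF i] by (metis abs_mult abs_of_pos)
    then have "w i * \<theta> i \<le> \<bar>t\<bar> * \<theta> i"
      using Hy[OF i] H_diag[OF i] by (simp add: mult.commute)
    then show "w i \<le> \<bar>\<Sum>k<n. sqrt (w k) * (\<Sum>j<n. V k j * y j) * A i k\<bar>"
      using \<theta>[OF i] by (simp add: t_def)
  qed
qed

section \<open>Banach spaces\<close>

text \<open>
  By the Cauchy-Schwarz inequality the tails of the coefficients \<open>sqrt (w k) * \<mu> n k\<close> are
  bounded in \<open>l\<^sup>1\<close> by the square roots of the tails of \<open>w\<close>, uniformly in \<open>n\<close>. So pointwise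
  convergence of the \<open>\<mu> n\<close>, available on a subsequence, makes the combinations converge in norm.
\<close>

lemma convergent_subsequence_of_combinations:
  fixes z :: "nat \<Rightarrow> 'a::banach" and w :: "nat \<Rightarrow> real"
  assumes z: "\<And>k. norm (z k) = 1" and w: "\<And>k. w k \<ge> 0" and "summable w"
    and \<mu>: "\<And>n m. (\<Sum>k<m. (\<mu> n k)\<^sup>2) \<le> 1" and zero: "\<And>n k. k \<ge> n \<Longrightarrow> \<mu> n k = 0"
  obtains r x where "strict_mono r"
    "(\<lambda>n. \<Sum>k<r n. (sqrt (w k) * \<mu> (r n) k) *\<^sub>R z k) \<longlonglongrightarrow> x"
proof -
  have "\<bar>\<mu> n k\<bar> \<le> 1" for n k
  proof -
    have "(\<mu> n k)\<^sup>2 \<le> (\<Sum>k<Suc k. (\<mu> n k)\<^sup>2)" by (simp add: sum_nonneg)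
    also have "\<dots> \<le> 1" by (rule \<mu>)
    finally show ?thesis by (simp add: abs_square_le_1)
  qed
  then have "\<mu> n k \<in> {-1..1}" for n k by (simp add: abs_le_iff minus_le_iff)
  then obtain l r where r: "strict_mono r" and l: "\<And>k. (\<lambda>n. \<mu> (r n) k) \<longlonglongrightarrow> l k"
    using pointwise_convergent_subsequence[of "\<lambda>_. {-1..1}" \<mu>] by (metis compact_Icc)
  define X where "X n = (\<Sum>k<n. (sqrt (w k) * \<mu> n k) *\<^sub>R z k)" for n
  have "Cauchy (\<lambda>n. X (r n))"
  proof (rule Cauchy_if_nearly_constant)
    fix e :: real assume e: "e > 0"
    obtain K where K: "\<And>m. norm (sum w {K..<m}) < (e / 2)\<^sup>2"
      using \<open>summable w\<close> e by (meson order_refl half_gt_zero summable_Cauchy zero_less_power)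
    define y where "y = (\<Sum>k<K. (sqrt (w k) * l k) *\<^sub>R z k)"
    define D where "D n = (\<Sum>k<K. norm ((sqrt (w k) * \<mu> (r n) k) *\<^sub>R z k - (sqrt (w k) * l k) *\<^sub>R z k))" for n
    have "D \<longlonglongrightarrow> (\<Sum>k<K. norm ((sqrt (w k) * l k) *\<^sub>R z k - (sqrt (w k) * l k) *\<^sub>R z k))"
      unfolding D_def by (intro tendsto_intros l)
    then have "D \<longlonglongrightarrow> 0" by simp
    then have "eventually (\<lambda>n. D n < e / 2) sequentially" using e by (intro order_tendstoD(2)) auto
    moreover have "dist (X (r n)) y < e" if "D n < e / 2" for n
    proof -
      define m where "m = max (r n) K"
      define c where "c k = (sqrt (w k) * \<mu> (r n) k) *\<^sub>R z k" for k
      have "X (r n) = (\<Sum>k<m. c k)"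
        unfolding X_def c_def by (rule sum.mono_neutral_left) (auto simp: m_def zero)
      also have "\<dots> = (\<Sum>k<K. c k) + (\<Sum>k=K..<m. c k)"
        using sum.atLeastLessThan_concat[of 0 K m c] by (simp add: m_def lessThan_atLeast0)
      finally have "norm (X (r n) - y) \<le> norm ((\<Sum>k<K. c k) - y) + norm (\<Sum>k=K..<m. c k)"
        by (metis add_diff_eq add.commute norm_triangle_ineq diff_add_eq)
      also have "norm ((\<Sum>k<K. c k) - y) \<le> D n"
        unfolding y_def D_def sum_subtractf[symmetric] c_def by (rule norm_sum)
      also have "norm (\<Sum>k=K..<m. c k) \<le> (\<Sum>k=K..<m. \<bar>sqrt (w k)\<bar> * \<bar>\<mu> (r n) k\<bar>)"
        by (rule sum_norm_le) (simp add: c_def z abs_mult)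
      also have "\<dots> \<le> L2_set (\<lambda>k. sqrt (w k)) {K..<m} * L2_set (\<mu> (r n)) {K..<m}"
        by (rule L2_set_mult_ineq)
      also have "\<dots> \<le> (e / 2) * 1"
      proof (rule mult_mono)
        have "L2_set (\<lambda>k. sqrt (w k)) {K..<m} = sqrt (sum w {K..<m})"
          by (simp add: L2_set_def w)
        also have "\<dots> \<le> sqrt ((e / 2)\<^sup>2)" using K[of m] by (intro real_sqrt_le_mono) auto
        finally show "L2_set (\<lambda>k. sqrt (w k)) {K..<m} \<le> e / 2" using e by simp
        have "(\<Sum>k=K..<m. (\<mu> (r n) k)\<^sup>2) \<le> (\<Sum>k<m. (\<mu> (r n) k)\<^sup>2)"
          by (rule sum_mono2) auto
        then show "L2_set (\<mu> (r n)) {K..<m} \<le> 1"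
          using \<mu>[where n = "r n" and m = m] by (simp add: L2_set_def)
      qed (use e in auto)
      finally show ?thesis using that by (simp add: dist_norm)
    qed
    ultimately show "\<exists>y. eventually (\<lambda>n. dist (X (r n)) y < e) sequentially"
      by (blast intro: eventually_mono)
  qed
  then obtain x where "(\<lambda>n. X (r n)) \<longlonglongrightarrow> x"
    using Cauchy_convergent convergent_def by blast
  with r show thesis unfolding X_def by (rule that)
qed

text \<open>
  The finite problems are solved by \<open>ball_matrix\<close> for the matrix \<open>f i (z k) / f i (z i)\<close>. The
  factor \<open>1/2\<close> is lost because \<open>z i\<close> only nearly norms \<open>S i\<close>.
\<close>

theorem banach_plank:
  fixes S :: "nat \<Rightarrow> 'a::banach \<Rightarrow>\<^sub>L 'b::real_normed_vector"
  assumes nz: "\<And>i. S i \<noteq> 0" and w: "\<And>i. w i > 0" and sum_w: "\<And>n. (\<Sum>i<n. w i) \<le> 1"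
  shows "\<exists>x. \<forall>i. w i * norm (S i) / 2 \<le> norm (S i x)"
proof -
  have "\<exists>z. norm z = 1 \<and> norm (S i) / 2 \<le> norm (S i z)" for i
    using blinfun_nearly_norming_vector[OF nz[of i]] by metis
  then obtain z where z: "\<And>i. norm (z i) = 1" and Sz: "\<And>i. norm (S i) / 2 \<le> norm (S i (z i))"
    by metis
  have "\<exists>f. linear f \<and> (\<forall>x. \<bar>f x\<bar> \<le> norm (S i x)) \<and> f (z i) = norm (S i (z i))" for i
    by (rule hahn_banach_real[of "\<lambda>x. norm (S i x)" "z i"])
       (auto simp: blinfun.add_right blinfun.scaleR_right norm_triangle_ineq)
  then obtain f where lin: "\<And>i. linear (f i)" and f_le: "\<And>i x. \<bar>f i x\<bar> \<le> norm (S i x)"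
    and fz: "\<And>i. f i (z i) = norm (S i (z i))" by metis
  have fpos: "f i (z i) > 0" for i
  proof -
    have "0 < norm (S i) / 2" using nz[of i] by simp
    also note Sz[of i]
    finally show ?thesis by (simp add: fz)
  qed
  define solves where "solves n \<nu> \<longleftrightarrow> (\<Sum>k<n. (\<nu> k)\<^sup>2) \<le> 1 \<and>
      (\<forall>i<n. w i \<le> \<bar>\<Sum>k<n. sqrt (w k) * \<nu> k * (f i (z k) / f i (z i))\<bar>)" for n \<nu>
  have "\<exists>\<nu>. solves n \<nu>" for n
  proof -
    have "f i (z i) / f i (z i) = 1" for i using fpos[of i] by simp
    then show ?thesis unfolding solves_def
      by (rule ball_matrix[of n "\<lambda>i k. f i (z k) / f i (z i)" w, OF _ w sum_w]) blast+
  qed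
  then obtain \<nu> where \<nu>: "\<And>n. solves n (\<nu> n)" by metis
  define \<mu> where "\<mu> n k = (if k < n then \<nu> n k else 0)" for n k :: nat
  have \<mu>1: "(\<Sum>k<m. (\<mu> n k)\<^sup>2) \<le> 1" for n m
  proof -
    have "(\<Sum>k<m. (\<mu> n k)\<^sup>2) = (\<Sum>k\<in>{..<m} \<inter> {..<n}. (\<nu> n k)\<^sup>2)"
      by (rule sum.mono_neutral_cong_right) (auto simp: \<mu>_def)
    also have "\<dots> \<le> (\<Sum>k<n. (\<nu> n k)\<^sup>2)" by (rule sum_mono2) auto
    also have "\<dots> \<le> 1" using \<nu>[of n] by (simp add: solves_def)
    finally show ?thesis .
  qed
  have zero: "\<mu> n k = 0" if "k \<ge> n" for n k using that by (simp add: \<mu>_def)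
  have "summable w"
    using w sum_w by (intro summableI_nonneg_bounded[of w 1]) (auto simp: less_imp_le)
  define X where "X n = (\<Sum>k<n. (sqrt (w k) * \<mu> n k) *\<^sub>R z k)" for n
  obtain r x where r: "strict_mono r" and lim: "(\<lambda>n. X (r n)) \<longlonglongrightarrow> x"
    by (rule convergent_subsequence_of_combinations[of z w \<mu>, OF z less_imp_le[OF w] \<open>summable w\<close> \<mu>1 zero, folded X_def])
  have X: "w i * norm (S i) / 2 \<le> norm (S i (X n))" if "i < n" for i n
  proof -
    define t where "t = (\<Sum>k<n. sqrt (w k) * \<nu> n k * (f i (z k) / f i (z i)))"
    have "f i (X n) = (\<Sum>k<n. sqrt (w k) * \<nu> n k * f i (z k))"
      unfolding X_def by (simp add: linear_sum[OF lin] linear_scale[OF lin] \<mu>_def)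
    also have "\<dots> = f i (z i) * t"
      unfolding t_def sum_distrib_left using fpos[of i] by (intro sum.cong) auto
    finally have "\<bar>f i (X n)\<bar> = f i (z i) * \<bar>t\<bar>"
      using fpos[of i] by (simp add: abs_mult)
    moreover have "w i \<le> \<bar>t\<bar>" unfolding t_def using \<nu>[of n] that unfolding solves_def by blast
    ultimately have "f i (z i) * w i \<le> \<bar>f i (X n)\<bar>"
      using fpos[of i] by simp
    with f_le[of i "X n"] have "f i (z i) * w i \<le> norm (S i (X n))" by simp
    moreover have "norm (S i) / 2 * w i \<le> f i (z i) * w i"
      using Sz[of i] fz[of i] w[of i] by (intro mult_right_mono) auto
    ultimately show ?thesis by (simp add: mult.commute)
  qed
  show ?thesis
  proof (intro exI allI)
    fix i
    have "(\<lambda>n. norm (S i (X (r n)))) \<longlonglongrightarrow> norm (S i x)"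
      by (intro tendsto_intros lim)
    moreover have "eventually (\<lambda>n. w i * norm (S i) / 2 \<le> norm (S i (X (r n)))) sequentially"
      using eventually_gt_at_top[of i]
      by eventually_elim (metis X r seq_suble order.strict_trans2)
    ultimately show "w i * norm (S i) / 2 \<le> norm (S i x)"
      by (rule tendsto_lowerbound) simp
  qed
qed

theorem banach_orbit_to_infinity:
  fixes S :: "nat \<Rightarrow> 'a::banach \<Rightarrow>\<^sub>L 'b::real_normed_vector"
  assumes nz: "\<And>i. S i \<noteq> 0" and sum: "summable (\<lambda>i. 1 / norm (S i))"
  shows "\<exists>x. filterlim (\<lambda>i. norm (S i x)) at_top sequentially"
proof -
  obtain a where a: "\<And>i. a i > 0" "\<And>n. (\<Sum>i<n. a i) \<le> 1"
    and lim: "filterlim (\<lambda>i. a i / (1 / norm (S i))) at_top sequentially"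
  proof -
    have "1 / norm (S i) > 0" for i using nz by simp
    from slowly_larger_summable[OF this sum] that show thesis by blast
  qed
  obtain x where x: "\<And>i. a i * norm (S i) / 2 \<le> norm (S i x)"
    using banach_plank[of S a, OF nz a] by blast
  have "filterlim (\<lambda>i. (1/2) * (a i / (1 / norm (S i)))) at_top sequentially"
    by (rule filterlim_tendsto_pos_mult_at_top[OF tendsto_const _ lim]) simp
  then have "filterlim (\<lambda>i. norm (S i x)) at_top sequentially"
    by (rule filterlim_at_top_mono) (use x in \<open>simp add: always_eventually\<close>)
  then show ?thesis ..
qed

section \<open>Complex Hilbert spaces\<close>

lemma hilbert_norm_add:
  fixes cs :: "complex \<Rightarrow> 'a::banach \<Rightarrow> 'a"
  assumes "hilbert_space_over cs ip"
  shows "(norm (u + v))\<^sup>2 = (norm u)\<^sup>2 + (norm v)\<^sup>2 + 2 * Re (ip u v)"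
proof -
  interpret hilbert_space_over cs ip by fact
  have herm: "ip v u = cnj (ip u v)" for u v
    using ip_hermitian[of v u] by (simp add: to_complex_complex_def)
  have "complex_of_real ((norm (u + v))\<^sup>2) = ip (u + v) (u + v)" by (rule ip_norm[symmetric])
  also have "\<dots> = ip u (u + v) + ip v (u + v)" by (rule ip_add_left)
  also have "\<dots> = cnj (ip (u + v) u) + cnj (ip (u + v) v)" using herm by metis
  also have "\<dots> = cnj (ip u u) + cnj (ip v u) + (cnj (ip u v) + cnj (ip v v))"
    by (simp only: ip_add_left complex_cnj_add)
  also have "\<dots> = complex_of_real ((norm u)\<^sup>2 + (norm v)\<^sup>2) + (ip u v + cnj (ip u v))"
    using herm[of v u] by (simp add: ip_norm)
  also have "\<dots> = complex_of_real ((norm u)\<^sup>2 + (norm v)\<^sup>2 + 2 * Re (ip u v))"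
    by (simp add: complex_add_cnj)
  finally show ?thesis using of_real_eq_iff by blast
qed

lemma hilbert_parallelogram:
  fixes cs :: "complex \<Rightarrow> 'a::banach \<Rightarrow> 'a"
    and x y :: 'a
  assumes "hilbert_space_over cs ip"
  shows "(norm (x + y))\<^sup>2 + (norm (x - y))\<^sup>2 = 2 * (norm x)\<^sup>2 + 2 * (norm y)\<^sup>2"
proof -
  interpret hilbert_space_over cs ip by fact
  have "ip (- y) x = - ip y x"
    using ip_smul_left[of "- 1" y x] by simp
  then have "Re (ip x (- y)) = - Re (ip x y)"
    using ip_hermitian[of x "- y"] ip_hermitian[of x y] by (simp add: to_complex_complex_def)
  then show ?thesis
    using hilbert_norm_add[OF assms, of x y] hilbert_norm_add[OF assms, of x "- y"] by simp
qed

text \<open>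
  Replacing the factor \<open>1 + b k * t\<close> by its Blaschke reflection \<open>(t + cnj (b k) * R\<^sup>2) / R\<close> does
  not change the modulus on the circle of radius \<open>R\<close>, but turns the value at \<open>0\<close> from \<open>1\<close> into
  \<open>cnj (b k) * R\<close>; the maximum principle applies to the new product. The bound limits the
  multiplicity of a zero \<open>- 1 / b k\<close> of a polynomial with constant term \<open>1\<close> that lies well
  inside the circle, as in Jensen's formula.
\<close>

lemma zero_far_from_origin:
  fixes b :: "'i \<Rightarrow> complex" and m :: "'i \<Rightarrow> nat"
  assumes "finite I" "k \<in> I" "R > 0"
    and bound: "\<And>t. cmod t = R \<Longrightarrow> (\<Prod>i\<in>I. cmod (1 + b i * t) ^ m i) \<le> B"
  shows "(cmod (b k) * R) ^ m k \<le> B"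
proof -
  define g where "g t = ((t + cnj (b k) * R\<^sup>2) / R) ^ m k * (\<Prod>i\<in>I - {k}. (1 + b i * t) ^ m i)" for t :: complex
  have hol: "g holomorphic_on UNIV"
    unfolding g_def using \<open>R > 0\<close> by (intro holomorphic_intros) auto
  have "cmod (g 0) \<le> B"
  proof (rule maximum_modulus_frontier[of g "ball 0 R"])
    show "g holomorphic_on interior (ball 0 R)" using hol holomorphic_on_subset by blast
    show "continuous_on (closure (ball 0 R)) g"
      using hol holomorphic_on_imp_continuous_on holomorphic_on_subset by blast
    fix t :: complex assume "t \<in> frontier (ball 0 R)"
    then have t: "cmod t = R" using \<open>R > 0\<close> by (simp add: frontier_ball)
    have "t + cnj (b k) * R\<^sup>2 = t * cnj (1 + b k * t)"
      using t complex_norm_square[of t] by (simp add: algebra_simps)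
    then have "cmod ((t + cnj (b k) * R\<^sup>2) / R) = cmod (1 + b k * t)"
      using t \<open>R > 0\<close> by (simp add: norm_divide norm_mult del: complex_cnj_add)
    then have "cmod (g t) = (\<Prod>i\<in>I. cmod (1 + b i * t) ^ m i)"
      using assms(1,2) by (simp add: g_def norm_mult norm_power prod_norm[symmetric] prod.remove[of I k])
    with bound[OF t] show "cmod (g t) \<le> B" by simp
  qed (use \<open>R > 0\<close> in auto)
  moreover have "cmod (g 0) = (cmod (b k) * R) ^ m k"
    using \<open>R > 0\<close> by (simp add: g_def norm_mult norm_divide norm_power power2_eq_square)
  ultimately show ?thesis by simp
qed

text \<open>
  A common non-zero of the first \<open>n\<close> functionals stays one when it is moved along \<open>z n\<close>, except
  for finitely many scalars.
\<close>

lemma common_nonzero_vector: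
  fixes cs :: "complex \<Rightarrow> 'a::real_normed_vector \<Rightarrow> 'a" and F :: "nat \<Rightarrow> 'a \<Rightarrow> complex"
  assumes add: "\<And>i x y. F i (x + y) = F i x + F i y"
    and scale: "\<And>i c x. F i (cs c x) = c * F i x"
    and nz: "\<And>i. i < n \<Longrightarrow> F i (z i) \<noteq> 0"
  shows "\<exists>x. \<forall>i<n. F i x \<noteq> 0"
  using nz
proof (induction n)
  case (Suc n)
  then obtain x where x: "\<And>i. i < n \<Longrightarrow> F i x \<noteq> 0" by auto
  show ?case
  proof (cases "F n x = 0")
    case False
    then show ?thesis using x less_Suc_eq by auto
  next
    case True
    have "finite (insert 0 ((\<lambda>i. - F i x / F i (z n)) ` {..<n}))" by simp
    then obtain t where "t \<notin> insert 0 ((\<lambda>i. - F i x / F i (z n)) ` {..<n})"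
      using ex_new_if_finite[OF infinite_UNIV_char_0] by blast
    then have t: "t \<noteq> 0" "\<And>i. i < n \<Longrightarrow> t \<noteq> - F i x / F i (z n)" by auto
    have "F i (x + cs t (z n)) \<noteq> 0" if "i < Suc n" for i
    proof (cases "i = n")
      case True
      then show ?thesis using \<open>F n x = 0\<close> t(1) Suc.prems[of n] by (simp add: add scale)
    next
      case False
      then have "i < n" using that by simp
      then show ?thesis
        using t(2)[of i] x[of i] by (cases "F i (z n) = 0") (auto simp: add scale field_simps eq_neg_iff_add_eq_0)
    qed
    then show ?thesis by blast
  qed
qed simp

text \<open>
  Choosing multiplicities \<open>m i\<close>, the proof looks at a unit vector \<open>p\<close> at which \<open>\<Phi>\<close>, the
  product of the \<open>cmod (F i x) ^ m i\<close>, exceeds half its supremum over the unit sphere. The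
  supremum need not be attained; the loss of a factor \<open>2\<close> becomes harmless in the \<open>m k\<close>-th root.
  If \<open>F k p\<close> is small, then \<open>F k\<close> is large at the component \<open>q\<close> of \<open>z k\<close> orthogonal to \<open>p\<close>, so
  \<open>t \<mapsto> F k (p + t q)\<close> has a zero near \<open>0\<close>, which \<open>zero_far_from_origin\<close> excludes.
\<close>

lemma complex_plank_finite:
  fixes cs :: "complex \<Rightarrow> 'a::banach \<Rightarrow> 'a" and F :: "nat \<Rightarrow> 'a \<Rightarrow> complex"
  assumes hilbert: "hilbert_space_over cs ip"
    and add: "\<And>i x y. F i (x + y) = F i x + F i y"
    and scale: "\<And>i c x. F i (cs c x) = c * F i x"
    and F_le: "\<And>i x. cmod (F i x) \<le> norm x"
    and z: "\<And>i. norm (z i) = 1" and Fz: "\<And>i. \<kappa> \<le> cmod (F i (z i))" and "\<kappa> > 0"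
    and a: "\<And>i. a i > 0" and sum_a: "(\<Sum>i<n. a i) \<le> 1"
  shows "\<exists>p. norm p \<le> 1 \<and> (\<forall>k<n. \<kappa> / 16 * sqrt (a k) \<le> cmod (F k p))"
proof (cases "n = 0")
  case True
  then show ?thesis by (intro exI[of _ 0]) simp
next
  case False
  interpret hilbert_space_over cs ip by fact
  have scaleR: "F i (r *\<^sub>R x) = r * F i x" for i r x
    using scale[of i "of_real r" x] smul_of_real[of r x] by simp
  \<comment> \<open>Rounding up keeps \<open>m i\<close> positive and makes \<open>m i / M\<close> at least \<open>a i / 2\<close>.\<close>
  define m where "m i = nat \<lceil>real n * a i\<rceil>" for i
  define M where "M = (\<Sum>i<n. m i)"
  have m_ge: "real n * a i \<le> m i" for i
    unfolding m_def by (rule real_nat_ceiling_ge)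
  have m_pos: "m i \<ge> 1" for i
  proof -
    have "0 < real n * a i" using False a by simp
    with m_ge[of i] have "0 < real (m i)" by linarith
    then show ?thesis by simp
  qed
  have "real M \<le> (\<Sum>i<n. real n * a i + 1)"
    unfolding M_def of_nat_sum
  proof (rule sum_mono)
    fix i
    have "0 \<le> real n * a i" using a[of i] by (simp add: less_imp_le)
    then show "real (m i) \<le> real n * a i + 1" unfolding m_def by linarith
  qed
  also have "\<dots> = real n * (\<Sum>i<n. a i) + real n" by (simp add: sum.distrib sum_distrib_left)
  also have "\<dots> \<le> 2 * real n" using mult_left_mono[OF sum_a, of "real n"] by simp
  finally have M_le: "real M \<le> 2 * real n" .
  have "M \<ge> m 0" unfolding M_def using False by (intro member_le_sum) auto
  then have M_pos: "M > 0" using m_pos[of 0] by simp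
  define \<Phi> where "\<Phi> x = (\<Prod>i<n. cmod (F i x) ^ m i)" for x
  define s where "s = Sup (\<Phi> ` {x. norm x = 1})"
  have \<Phi>_scaleR: "\<Phi> (r *\<^sub>R x) = \<bar>r\<bar> ^ M * \<Phi> x" for r x
    by (simp add: \<Phi>_def scaleR norm_mult power_mult_distrib prod.distrib M_def power_sum)
  have "\<Phi> x \<le> 1" if "norm x = 1" for x
    unfolding \<Phi>_def using F_le[of _ x] that by (intro prod_le_1 conjI power_le_one) auto
  then have bdd: "bdd_above (\<Phi> ` {x. norm x = 1})" by (auto intro!: bdd_aboveI[of _ 1])
  have \<Phi>_le_s: "\<Phi> x \<le> s" if "norm x = 1" for x
    unfolding s_def using that bdd by (intro cSup_upper) auto
  have homog: "\<Phi> x \<le> s * norm x ^ M" if "x \<noteq> 0" for x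
  proof -
    have "\<Phi> ((1 / norm x) *\<^sub>R x) \<le> s" using that by (intro \<Phi>_le_s) simp
    then have "(1 / norm x) ^ M * \<Phi> x \<le> s" by (simp add: \<Phi>_scaleR)
    then show ?thesis using that by (simp add: power_one_over field_simps)
  qed
  obtain x0 where x0: "\<And>i. i < n \<Longrightarrow> F i x0 \<noteq> 0"
  proof -
    have "F i (z i) \<noteq> 0" for i using Fz[of i] \<open>\<kappa> > 0\<close> by auto
    then show thesis using common_nonzero_vector[of F cs n z, OF add scale] that by blast
  qed
  have "x0 \<noteq> 0" using x0[of 0] F_le[of 0 0] False by auto
  have "\<Phi> x0 > 0" unfolding \<Phi>_def using x0 by (intro prod_pos) simp
  with homog[OF \<open>x0 \<noteq> 0\<close>] have "s * norm x0 ^ M > 0" by linarith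
  then have s_pos: "s > 0" using \<open>x0 \<noteq> 0\<close> by (simp add: zero_less_mult_iff)
  have "\<exists>y\<in>\<Phi> ` {x. norm x = 1}. s / 2 < y"
    using s_pos z[of 0] bdd unfolding s_def by (intro less_cSupD) auto
  then obtain p where p: "norm p = 1" and \<Phi>p: "s / 2 < \<Phi> p" by auto
  have \<Phi>p_pos: "\<Phi> p > 0" using \<Phi>p s_pos by simp
  have Fp: "F i p \<noteq> 0" if "i < n" for i
  proof
    assume "F i p = 0"
    then have "\<Phi> p = 0" unfolding \<Phi>_def using that m_pos[of i] by (intro prod_zero) auto
    with \<Phi>p_pos show False by simp
  qed
  have "\<kappa> / 16 * sqrt (a k) \<le> cmod (F k p)" if k: "k < n" for k
  proof -
    have ak: "a k \<le> 1"
    proof -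
      have "a k \<le> (\<Sum>i<n. a i)" using k a by (intro member_le_sum) (auto simp: less_imp_le)
      with sum_a show ?thesis by simp
    qed
    then have sqrt_ak: "sqrt (a k) \<le> 1" by simp
    show ?thesis
    proof (cases "\<kappa> / 2 \<le> cmod (F k p)")
      case True
      have "\<kappa> / 16 * sqrt (a k) \<le> \<kappa> / 16 * 1"
        using sqrt_ak \<open>\<kappa> > 0\<close> by (intro mult_left_mono) auto
      with True \<open>\<kappa> > 0\<close> show ?thesis by linarith
    next
      case small: False
      define \<alpha> where "\<alpha> = ip (z k) p"
      define q where "q = z k - cs \<alpha> p"
      have minus: "ip (- u) v = - ip u v" for u v
        using ip_smul_left[of "- 1" u v] by simp
      have "ip p p = 1" using ip_norm[of p] p by simp
      then have qp: "ip q p = 0"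
        using ip_add_left[of "z k" "- cs \<alpha> p" p] by (simp add: q_def minus ip_smul_left \<alpha>_def)
      then have pq: "ip p q = 0" using ip_hermitian[of p q] by (simp add: to_complex_complex_def)
      have \<alpha>_split: "1 = (norm q)\<^sup>2 + (cmod \<alpha>)\<^sup>2"
      proof -
        have "ip (cs \<alpha> p) q = 0" by (simp add: ip_smul_left pq)
        with hilbert_norm_add[OF hilbert, of "cs \<alpha> p" q] z[of k]
        show ?thesis by (simp add: q_def norm_smul p)
      qed
      then have "(norm q)\<^sup>2 \<le> 1" "(cmod \<alpha>)\<^sup>2 \<le> 1"
        using zero_le_power2[of "norm q"] zero_le_power2[of "cmod \<alpha>"] by linarith+
      then have \<alpha>_le: "cmod \<alpha> \<le> 1" by (simp add: abs_square_le_1)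
      have "F k (z k) = F k q + \<alpha> * F k p"
        using add[of k q "cs \<alpha> p"] by (simp add: q_def scale)
      then have "\<kappa> \<le> cmod (F k q) + cmod \<alpha> * cmod (F k p)"
        using Fz[of k] norm_triangle_ineq[of "F k q" "\<alpha> * F k p"] by (simp add: norm_mult)
      moreover have "cmod \<alpha> * cmod (F k p) \<le> 1 * cmod (F k p)"
        using \<alpha>_le by (intro mult_right_mono) auto
      ultimately have Fq: "\<kappa> / 2 \<le> cmod (F k q)" using small by simp
      define b where "b i = F i q / F i p" for i
      \<comment> \<open>On this circle \<open>(norm (p + t q)) ^ M\<close> is at most \<open>exp (m k / 2)\<close>, a power with
        exponent proportional to \<open>m k\<close>.\<close>
      define R where "R = sqrt (real (m k) / real M)"
      have R: "R > 0" "R\<^sup>2 = real (m k) / real M"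
        using m_pos[of k] M_pos by (simp_all add: R_def)
      have bound: "(\<Prod>i<n. cmod (1 + b i * t) ^ m i) \<le> 4 ^ m k" if t: "cmod t = R" for t
      proof -
        define f where "f = (\<Prod>i<n. cmod (1 + b i * t) ^ m i)"
        define y where "y = p + cs t q"
        have "ip p (cs t q) = 0"
        proof -
          have "ip (cs t q) p = 0" by (simp add: ip_smul_left qp)
          then show ?thesis using ip_hermitian[of p "cs t q"] by (simp add: to_complex_complex_def)
        qed
        with hilbert_norm_add[OF hilbert, of p "cs t q"]
        have ny: "(norm y)\<^sup>2 = 1 + R\<^sup>2 * (norm q)\<^sup>2"
          by (simp add: y_def p norm_smul t power_mult_distrib)
        then have "(norm y)\<^sup>2 \<noteq> 0" by (metis add_pos_nonneg less_irrefl zero_less_one zero_le_mult_iff zero_le_power2)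
        then have "y \<noteq> 0" by auto
        have ny_le: "(norm y)\<^sup>2 \<le> exp (R\<^sup>2)"
        proof -
          have "(norm y)\<^sup>2 \<le> 1 + R\<^sup>2"
            using ny mult_left_mono[OF \<open>(norm q)\<^sup>2 \<le> 1\<close>, of "R\<^sup>2"] by simp
          also have "\<dots> \<le> exp (R\<^sup>2)" by (rule exp_ge_add_one_self)
          finally show ?thesis .
        qed
        have "F i y = F i p * (1 + b i * t)" if "i < n" for i
          using Fp[OF that] by (simp add: y_def add scale b_def field_simps)
        then have "\<Phi> y = \<Phi> p * f"
          by (simp add: \<Phi>_def f_def norm_mult power_mult_distrib prod.distrib)
        moreover have "\<Phi> y \<le> s * norm y ^ M" by (rule homog[OF \<open>y \<noteq> 0\<close>])
        moreover have "s * norm y ^ M \<le> 2 * \<Phi> p * norm y ^ M"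
          using \<Phi>p by (intro mult_right_mono) auto
        ultimately have "\<Phi> p * f \<le> \<Phi> p * (2 * norm y ^ M)" by (simp add: mult_ac)
        then have f_le: "f \<le> 2 * norm y ^ M" using \<Phi>p_pos by simp
        have f0: "0 \<le> f" by (simp add: f_def prod_nonneg)
        have "f\<^sup>2 \<le> (2 * norm y ^ M)\<^sup>2" using f_le f0 by (rule power_mono)
        also have "\<dots> = 4 * ((norm y)\<^sup>2) ^ M" by (simp add: power_mult_distrib flip: power_mult) (simp add: mult.commute)
        also have "\<dots> \<le> 4 * exp (R\<^sup>2) ^ M" using ny_le by (intro mult_left_mono power_mono) auto
        also have "exp (R\<^sup>2) ^ M = exp 1 ^ m k"
          using R(2) M_pos by (simp add: exp_of_nat_mult[symmetric])
        also have "4 * exp (1::real) ^ m k \<le> 4 ^ m k * 4 ^ m k"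
        proof (rule mult_mono)
          show "(4::real) \<le> 4 ^ m k" using power_increasing[OF m_pos[of k], of "4::real"] by simp
          show "exp (1::real) ^ m k \<le> 4 ^ m k" using exp_le by (intro power_mono) auto
        qed auto
        also have "\<dots> = (4 ^ m k)\<^sup>2" by (simp add: power2_eq_square)
        finally show ?thesis unfolding f_def[symmetric] by (rule power2_le_imp_le) simp
      qed
      have "(cmod (b k) * R) ^ m k \<le> 4 ^ m k"
        using k R(1) bound by (intro zero_far_from_origin[of "{..<n}"]) auto
      then have "cmod (b k) * R \<le> 4"
        using m_pos[of k] R(1) by (subst (asm) power_mono_iff) auto
      then have "cmod (F k q) * R \<le> 4 * cmod (F k p)"
        using Fp[OF k] by (simp add: b_def norm_divide field_simps)
      moreover have "\<kappa> / 2 * (sqrt (a k) / 2) \<le> cmod (F k q) * R"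
      proof (rule mult_mono[OF Fq])
        have "a k / 4 \<le> real (m k) / real M"
        proof -
          have "a k * real M \<le> a k * (2 * real n)" using M_le a[of k] by (intro mult_left_mono) auto
          also have "\<dots> \<le> 2 * real (m k)" using m_ge[of k] by (simp add: mult_ac)
          finally have "a k * real M \<le> 2 * real (m k)" .
          then show ?thesis using M_pos m_pos[of k] by (simp add: field_simps)
        qed
        then have "sqrt (a k / 4) \<le> R" unfolding R_def by (rule real_sqrt_le_mono)
        then show "sqrt (a k) / 2 \<le> R" by (simp add: real_sqrt_divide)
      qed (use a[of k] in \<open>auto simp: less_imp_le\<close>)
      ultimately show ?thesis by (simp add: field_simps)
    qed
  qed
  with p show ?thesis by (intro exI[of _ p]) simp
qed

text \<open>
  Weak sequential compactness of the ball without a representation theorem. The distances \<open>d n\<close>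
  from \<open>0\<close> to the convex hulls of the tails of \<open>X\<close> increase to a limit \<open>D\<close>; by the parallelogram
  law, elements of these hulls that nearly realise the distance form a Cauchy sequence. A
  functional value at a point of the \<open>n\<close>-th hull is as close to \<open>c i\<close> as the values at the \<open>X m\<close>
  with \<open>m \<ge> n\<close> are, so the limit solves all equations.
\<close>

lemma weak_limit_exists:
  fixes X :: "nat \<Rightarrow> 'a::banach" and F :: "'i \<Rightarrow> 'a \<Rightarrow> 'b::real_normed_vector"
  assumes parallelogram: "\<And>x y :: 'a. (norm (x + y))\<^sup>2 + (norm (x - y))\<^sup>2 = 2 * (norm x)\<^sup>2 + 2 * (norm y)\<^sup>2"
    and X: "\<And>n. norm (X n) \<le> B" and F: "\<And>i. bounded_linear (F i)"
    and lim: "\<And>i. (\<lambda>n. F i (X n)) \<longlonglongrightarrow> c i"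
  shows "\<exists>x. \<forall>i. F i x = c i"
proof -
  define C where "C n = convex hull (X ` {n..})" for n
  define d where "d n = Inf (norm ` C n)" for n
  have C_mono: "C m \<subseteq> C n" if "n \<le> m" for n m
    unfolding C_def using that by (intro hull_mono image_mono) auto
  have XC: "X n \<in> C n" for n unfolding C_def by (rule hull_inc) simp
  have bdd: "bdd_below (norm ` C n)" for n by (auto intro!: bdd_belowI[of _ 0])
  have d_le: "d n \<le> norm y" if "y \<in> C n" for n y
    unfolding d_def using that bdd by (intro cInf_lower) auto
  have d_ge: "0 \<le> d n" for n
    unfolding d_def using XC by (intro cInf_greatest) auto
  have inc: "incseq d"
  proof (unfold incseq_def, intro allI impI)
    fix n m :: nat assume "n \<le> m"
    then show "d n \<le> d m"
      unfolding d_def using C_mono[of n m] bdd XC[of m] by (intro cInf_superset_mono) auto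
  qed
  moreover have d_B: "d n \<le> B" for n by (rule order_trans[OF d_le[OF XC] X])
  ultimately obtain D where D: "d \<longlonglongrightarrow> D" and d_D: "\<And>n. d n \<le> D"
    using incseq_convergent[of d B] by metis
  define e where "e n = d n + 1 / real (Suc n)" for n
  have "\<exists>y\<in>C n. norm y < e n" for n
  proof -
    have "norm ` C n \<noteq> {}" "Inf (norm ` C n) < e n"
      using XC[of n] by (auto simp: e_def d_def)
    from cInf_lessD[OF this] show ?thesis by blast
  qed
  then obtain y where y: "\<And>n. y n \<in> C n" and ny: "\<And>n. norm (y n) < e n" by metis
  define \<eta> where "\<eta> n = D + 1 / real (Suc n)" for n
  define \<delta> where "\<delta> n = 4 * (\<eta> n)\<^sup>2 - 4 * (d n)\<^sup>2" for n
  have inv0: "(\<lambda>n. 1 / real (Suc n)) \<longlonglongrightarrow> 0"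
    using LIMSEQ_inverse_real_of_nat by (simp add: inverse_eq_divide)
  have "\<delta> \<longlonglongrightarrow> 4 * (D + 0)\<^sup>2 - 4 * D\<^sup>2"
    unfolding \<delta>_def \<eta>_def by (intro tendsto_intros inv0 D)
  then have \<delta>0: "\<delta> \<longlonglongrightarrow> 0" by simp
  have close: "(norm (y n - y m))\<^sup>2 \<le> \<delta> n" if "n \<le> m" for n m
  proof -
    have "y m \<in> C n" using C_mono[OF that] y by blast
    then have "(1/2) *\<^sub>R y n + (1/2) *\<^sub>R y m \<in> C n"
      using y[of n] convex_convex_hull[of "X ` {n..}"] unfolding C_def by (intro convexD) auto
    from d_le[OF this] have "2 * d n \<le> norm (y n + y m)"
      by (simp flip: scaleR_add_right)
    then have "(2 * d n)\<^sup>2 \<le> (norm (y n + y m))\<^sup>2" using d_ge by (intro power_mono) auto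
    moreover have "norm (y k) \<le> \<eta> n" if "n \<le> k" for k
    proof -
      have "1 / real (Suc k) \<le> 1 / real (Suc n)" using that by (simp add: frac_le)
      then show ?thesis using ny[of k] d_D[of k] unfolding e_def \<eta>_def by linarith
    qed
    then have "(norm (y n))\<^sup>2 \<le> (\<eta> n)\<^sup>2" "(norm (y m))\<^sup>2 \<le> (\<eta> n)\<^sup>2"
      using that by (intro power_mono norm_ge_zero; simp)+
    moreover have "(2 * d n)\<^sup>2 = 4 * (d n)\<^sup>2" by (simp add: power_mult_distrib)
    ultimately show ?thesis
      using parallelogram[of "y n" "y m"] unfolding \<delta>_def by linarith
  qed
  have "Cauchy y"
  proof (rule Cauchy_if_nearly_constant)
    fix r :: real assume r: "r > 0"
    have "eventually (\<lambda>n. \<delta> n < r\<^sup>2) sequentially"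
      using order_tendstoD(2)[OF \<delta>0, of "r\<^sup>2"] r by simp
    then obtain n where "\<forall>m\<ge>n. \<delta> m < r\<^sup>2" unfolding eventually_sequentially by blast
    then have n: "\<delta> n < r\<^sup>2" by simp
    have "dist (y m) (y n) < r" if "n \<le> m" for m
    proof -
      have "(norm (y n - y m))\<^sup>2 < r\<^sup>2" using close[OF that] n by simp
      then have "norm (y n - y m) < r" by (rule power2_less_imp_less) (use r in simp)
      then show ?thesis by (simp add: dist_norm norm_minus_commute)
    qed
    then have "eventually (\<lambda>m. dist (y m) (y n) < r) sequentially"
      by (rule eventually_sequentiallyI)
    then show "\<exists>x. eventually (\<lambda>m. dist (y m) x < r) sequentially" ..
  qed
  then have "convergent y" by (rule Cauchy_convergent)
  then obtain x where x: "y \<longlonglongrightarrow> x" by (auto simp: convergent_def)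
  have "F i x = c i" for i
  proof -
    have "(\<lambda>n. F i (y n)) \<longlonglongrightarrow> F i x" by (rule bounded_linear.tendsto[OF F x])
    moreover have "(\<lambda>n. F i (y n)) \<longlonglongrightarrow> c i"
    proof (rule metric_LIMSEQ_I)
      fix r :: real assume r: "r > 0"
      then obtain N where N: "\<And>n. n \<ge> N \<Longrightarrow> dist (F i (X n)) (c i) < r"
        using metric_LIMSEQ_D[OF lim[of i], of r] by blast
      have "dist (F i (y n)) (c i) < r" if "n \<ge> N" for n
      proof -
        have "F i ` C n = convex hull (F i ` X ` {n..})"
          unfolding C_def by (rule convex_hull_linear_image) (rule bounded_linear.linear[OF F])
        also have "\<dots> \<subseteq> ball (c i) r"
          using N that by (intro hull_minimal convex_ball) (auto simp: dist_commute)
        finally show ?thesis using y[of n] by (auto simp: dist_commute)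
      qed
      then show "\<exists>N. \<forall>n\<ge>N. dist (F i (y n)) (c i) < r" by blast
    qed
    ultimately show ?thesis by (rule LIMSEQ_unique)
  qed
  then show ?thesis by blast
qed

text \<open>
  A factor \<open>16\<close> is lost in \<open>complex_plank_finite\<close>, and a factor \<open>2\<close> because \<open>z i\<close> only nearly
  norms \<open>S i\<close>.
\<close>

theorem hilbert_plank:
  fixes cs :: "complex \<Rightarrow> 'a::banach \<Rightarrow> 'a" and S :: "nat \<Rightarrow> 'a \<Rightarrow>\<^sub>L 'b::real_normed_vector"
  assumes hilbert: "hilbert_space_over cs ip"
    and S_scale: "\<And>i c x. norm (S i (cs c x)) = cmod c * norm (S i x)"
    and nz: "\<And>i. S i \<noteq> 0" and a: "\<And>i. a i > 0" and sum_a: "\<And>n. (\<Sum>i<n. a i) \<le> 1"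
  shows "\<exists>x. \<forall>i. sqrt (a i) * norm (S i) / 32 \<le> norm (S i x)"
proof -
  interpret hilbert_space_over cs ip by fact
  have "\<exists>z. norm z = 1 \<and> norm (S i) / 2 \<le> norm (S i z)" for i
    using blinfun_nearly_norming_vector[OF nz[of i]] by metis
  then obtain z where z: "\<And>i. norm (z i) = 1" and Sz: "\<And>i. norm (S i) / 2 \<le> norm (S i (z i))"
    by metis
  define p where "p i x = norm (S i x) / norm (S i)" for i x
  have p_tri: "p i (x + y) \<le> p i x + p i y" for i x y
    by (simp add: p_def blinfun.add_right norm_triangle_ineq divide_right_mono flip: add_divide_distrib)
  have p_scale: "p i (cs c x) = cmod c * p i x" for i c x
    by (simp add: p_def S_scale)
  have p_le: "p i x \<le> norm x" for i x
    using norm_blinfun[of "S i" x] nz[of i] by (simp add: p_def divide_le_eq mult.commute)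
  have pz: "1 / 2 \<le> p i (z i)" for i
    using Sz[of i] nz[of i] by (simp add: p_def field_simps)
  define adm where "adm i F \<longleftrightarrow> (\<forall>x y. F (x + y) = F x + F y) \<and> (\<forall>c x. F (cs c x) = c * F x) \<and>
    (\<forall>x. cmod (F x) \<le> p i x) \<and> cmod (F (z i)) = p i (z i)" for i F
  have "\<exists>F. adm i F" for i
    by (rule hahn_banach_complex[of cs "p i" "z i", OF normed_space_over_axioms p_tri p_scale])
       (unfold adm_def, blast)
  then obtain F where adm: "\<And>i. adm i (F i)" by metis
  have add: "F i (x + y) = F i x + F i y" and scale: "F i (cs c x) = c * F i x"
    and F_p: "cmod (F i x) \<le> p i x" and Fz: "1 / 2 \<le> cmod (F i (z i))" for i x y c
    using adm[of i] pz[of i] by (simp_all add: adm_def)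
  have F_le: "cmod (F i x) \<le> norm x" for i x using F_p p_le order_trans by blast
  have lin: "bounded_linear (F i)" for i
  proof (rule bounded_linear_intro)
    show "F i (r *\<^sub>R x) = r *\<^sub>R F i x" for r x
      using scale[of i "of_real r" x] smul_of_real[of r x] by (simp add: scaleR_conv_of_real)
    show "cmod (F i x) \<le> norm x * 1" for x using F_le by simp
  qed (rule add)
  have "\<exists>x. norm x \<le> 1 \<and> (\<forall>k<n. (1/2) / 16 * sqrt (a k) \<le> cmod (F k x))" for n
    by (rule complex_plank_finite[OF hilbert add scale F_le z Fz _ a sum_a]) simp
  then obtain X where X: "\<And>n. norm (X n) \<le> 1"
    and XF: "\<And>n k. k < n \<Longrightarrow> (1/2) / 16 * sqrt (a k) \<le> cmod (F k (X n))" by metis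
  have ball: "F k (X n) \<in> cball 0 1" for n k
    using F_le[of k "X n"] X[of n] by simp
  obtain c r where r: "strict_mono r" and c: "\<And>k. (\<lambda>n. F k (X (r n))) \<longlonglongrightarrow> c k"
    using pointwise_convergent_subsequence[of "\<lambda>_. cball 0 1" "\<lambda>n k. F k (X n)", OF compact_cball ball] by blast
  obtain x where x: "\<And>k. F k x = c k"
    using weak_limit_exists[of "\<lambda>n. X (r n)" 1 F c, OF hilbert_parallelogram[OF hilbert] X lin c] by blast
  have "sqrt (a k) * norm (S k) / 32 \<le> norm (S k x)" for k
  proof -
    have "(1/2) / 16 * sqrt (a k) \<le> cmod (c k)"
    proof (rule tendsto_lowerbound)
      show "(\<lambda>n. cmod (F k (X (r n)))) \<longlonglongrightarrow> cmod (c k)" by (intro tendsto_intros c)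
      show "eventually (\<lambda>n. (1/2) / 16 * sqrt (a k) \<le> cmod (F k (X (r n)))) sequentially"
        using eventually_gt_at_top[of k]
        by eventually_elim (metis XF r seq_suble order.strict_trans2)
    qed simp
    also have "\<dots> \<le> norm (S k x) / norm (S k)" using F_p[of k x] by (simp add: x p_def)
    finally show ?thesis using nz[of k] by (simp add: field_simps)
  qed
  then show ?thesis by blast
qed

theorem hilbert_orbit_to_infinity:
  fixes cs :: "complex \<Rightarrow> 'a::banach \<Rightarrow> 'a" and S :: "nat \<Rightarrow> 'a \<Rightarrow>\<^sub>L 'b::real_normed_vector"
  assumes hilbert: "hilbert_space_over cs ip"
    and S_scale: "\<And>i c x. norm (S i (cs c x)) = cmod c * norm (S i x)"
    and nz: "\<And>i. S i \<noteq> 0" and sum: "summable (\<lambda>i. 1 / (norm (S i))\<^sup>2)"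
  shows "\<exists>x. filterlim (\<lambda>i. norm (S i x)) at_top sequentially"
proof -
  obtain a where a: "\<And>i. a i > 0" "\<And>n. (\<Sum>i<n. a i) \<le> 1"
    and lim: "filterlim (\<lambda>i. a i / (1 / (norm (S i))\<^sup>2)) at_top sequentially"
  proof -
    have "1 / (norm (S i))\<^sup>2 > 0" for i using nz by simp
    from slowly_larger_summable[OF this sum] that show thesis by blast
  qed
  obtain x where x: "\<And>i. sqrt (a i) * norm (S i) / 32 \<le> norm (S i x)"
    using hilbert_plank[of cs ip S a, OF hilbert S_scale nz a] by blast
  have "filterlim (\<lambda>i. sqrt (a i / (1 / (norm (S i))\<^sup>2))) at_top sequentially"
    by (rule filterlim_compose[OF sqrt_at_top lim])
  then have "filterlim (\<lambda>i. (1/32) * sqrt (a i / (1 / (norm (S i))\<^sup>2))) at_top sequentially"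
    by (intro filterlim_tendsto_pos_mult_at_top[OF tendsto_const]) auto
  then have "filterlim (\<lambda>i. norm (S i x)) at_top sequentially"
    by (rule filterlim_at_top_mono) (use x in \<open>simp add: always_eventually real_sqrt_mult\<close>)
  then show ?thesis ..
qed

section \<open>Several sequences of operators\<close>

text \<open>
  A vanishing \<open>c k\<close> would contribute an infinite term, since \<open>1 / 0 = \<infinity>\<close> for extended
  nonnegative reals.
\<close>

lemma summable_inverse_if_ennreal_finite:
  fixes c :: "nat \<Rightarrow> real"
  assumes nonneg: "\<And>k. c k \<ge> 0" and fin: "(\<Sum>k. 1 / ennreal (c k)) < \<infinity>"
  shows "c k > 0" and "summable (\<lambda>k. 1 / c k)"
proof -
  have pos: "c k > 0" for k
  proof (rule ccontr)
    assume "\<not> c k > 0"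
    then have "c k = 0" using nonneg[of k] by simp
    then have "1 / ennreal (c k) = \<infinity>" by (simp add: divide_ennreal_def)
    moreover have "1 / ennreal (c k) \<le> (\<Sum>k. 1 / ennreal (c k))"
      using sum_le_suminf[of "\<lambda>k. 1 / ennreal (c k)" "{k}"] by simp
    ultimately show False using fin by (simp add: top_unique)
  qed
  then show "c k > 0" .
  have "1 / ennreal (c k) = ennreal (1 / c k)" for k
    using divide_ennreal[of 1 "c k"] pos[of k] by simp
  then show "summable (\<lambda>k. 1 / c k)"
    using fin nonneg by (intro summable_suminf_not_top) (auto simp: less_top)
qed

lemma summable_interleave:
  fixes g :: "nat \<Rightarrow> nat \<Rightarrow> real"
  assumes "N > 0" and nonneg: "\<And>j k. g j k \<ge> 0" and sum: "\<And>j. j < N \<Longrightarrow> summable (g j)"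
  shows "summable (\<lambda>i. g (i mod N) (i div N))"
proof (rule summableI_nonneg_bounded)
  show "0 \<le> g (i mod N) (i div N)" for i by (rule nonneg)
  fix n
  let ?f = "\<lambda>i. g (i mod N) (i div N)"
  have "(\<Sum>i<n. ?f i) \<le> (\<Sum>i<n * N. ?f i)"
    using \<open>N > 0\<close> nonneg by (intro sum_mono2) auto
  also have "\<dots> = (\<Sum>m<n. \<Sum>i=m * N..<m * N + N. ?f i)" by (rule sum.nat_group[symmetric])
  also have "\<dots> = (\<Sum>m<n. \<Sum>j<N. g j m)"
  proof (rule sum.cong)
    fix m
    have "i div N = m" if "m * N \<le> i" "i < m * N + N" for i
      using that by (intro div_nat_eqI) (simp_all add: mult.commute)
    then show "(\<Sum>i=m * N..<m * N + N. ?f i) = (\<Sum>j<N. g j m)"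
      by (intro sum.reindex_bij_witness[of _ "\<lambda>j. m * N + j" "\<lambda>i. i - m * N"])
         (auto simp: modulo_nat_def)
  qed simp
  also have "\<dots> = (\<Sum>j<N. \<Sum>m<n. g j m)" by (rule sum.swap)
  also have "\<dots> \<le> (\<Sum>j<N. suminf (g j))"
    using sum nonneg by (intro sum_mono sum_le_suminf) auto
  finally show "(\<Sum>i<n. ?f i) \<le> (\<Sum>j<N. suminf (g j))" .
qed

text \<open>
  The scalar field of a complex Hilbert space is an isometric copy of \<open>complex\<close>; transporting
  the structure along this isometry allows scalars to be used as arguments of holomorphic
  functions.
\<close>

lemma complex_hilbert_space_imp_complex_scalars:
  fixes sX :: "'k::real_or_complex \<Rightarrow> 'a::banach \<Rightarrow> 'a"
  assumes "complex_hilbert_space sX"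
  obtains e :: "complex \<Rightarrow> 'k" and ip where "\<And>c. norm (e c) = cmod c"
    "hilbert_space_over (\<lambda>c. sX (e c)) ip"
proof -
  obtain ip where surj: "range (to_complex :: 'k \<Rightarrow> complex) = UNIV" and "hilbert_space_over sX ip"
    using assms by (auto simp: complex_hilbert_space_def)
  interpret hilbert_space_over sX ip by fact
  define e :: "complex \<Rightarrow> 'k" where "e = inv to_complex"
  have te: "to_complex (e c) = c" for c
    unfolding e_def using surj by (simp add: surj_f_inv_f)
  have inj: "u = v" if "to_complex u = to_complex v" for u v :: 'k
  proof -
    have "to_complex (u + (- 1) *\<^sub>R v) = 0"
      using that by (simp only: to_complex_add to_complex_scaleR) simp
    then show ?thesis using norm_to_complex[of "u + (- 1) *\<^sub>R v"] by simp
  qed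
  have e_add: "e (c + d) = e c + e d" for c d by (rule inj) (simp add: te to_complex_add)
  have e_mult: "e (c * d) = e c * e d" for c d by (rule inj) (simp add: te to_complex_mult)
  have t_real: "to_complex (of_real r :: 'k) = of_real r" for r
    by (simp add: of_real_def to_complex_scaleR to_complex_one)
  have e_real: "e (of_real r) = of_real r" for r by (rule inj) (simp add: te t_real)
  have e_one: "e 1 = 1" using e_real[of 1] by simp
  have "hilbert_space_over (\<lambda>c. sX (e c)) (\<lambda>x y. to_complex (ip x y))"
  proof unfold_locales
    show "norm (sX (e c) x) = norm c * norm x" for c x
      using norm_to_complex[of "e c"] by (simp add: norm_smul te)
    show "to_complex (ip (x + y) z) = to_complex (ip x z) + to_complex (ip y z)" for x y z
      by (simp add: ip_add_left to_complex_add)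
    show "to_complex (ip (sX (e c) x) y) = c * to_complex (ip x y)" for c x y
      by (simp add: ip_smul_left to_complex_mult te)
    show "to_complex (to_complex (ip y x)) = cnj (to_complex (to_complex (ip x y)))" for x y
      by (simp add: to_complex_complex_def ip_hermitian[of y x])
    show "to_complex (ip x x) = of_real ((norm x)\<^sup>2)" for x
      unfolding ip_norm by (rule t_real)
  qed (simp_all add: e_add e_mult e_one e_real scale_right_distrib scale_left_distrib smul_of_real)
  moreover have "norm (e c) = cmod c" for c using norm_to_complex[of "e c"] by (simp add: te)
  ultimately show thesis by (rule that[rotated])
qed

theorem proposition4p9:
  fixes N :: nat
    and sX :: "'k::real_or_complex \<Rightarrow> 'a::banach \<Rightarrow> 'a"
    and sY :: "'k \<Rightarrow> 'b::banach \<Rightarrow> 'b"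
    and T :: "nat \<Rightarrow> nat \<Rightarrow> 'a \<Rightarrow>\<^sub>L 'b"
  assumes "N \<ge> 2"
    and "normed_space_over sX" and "\<exists>x::'a. x \<noteq> 0"
    and "normed_space_over sY" and "\<exists>y::'b. y \<noteq> 0"
    and "\<And>j k. j \<in> {1..N} \<Longrightarrow> k \<ge> 1 \<Longrightarrow> T j k \<in> bounded_operators sX sY"
    and "(\<forall>j\<in>{1..N}. (\<Sum>k. 1 / ennreal (norm (T j (Suc k)))) < \<infinity>) \<or>
      (complex_hilbert_space sX \<and>
        (\<forall>j\<in>{1..N}. (\<Sum>k. 1 / (ennreal (norm (T j (Suc k))))\<^sup>2) < \<infinity>))"
  shows "\<exists>x::'a. \<forall>j\<in>{1..N}.
    filterlim (\<lambda>k. norm (blinfun_apply (T j k) x)) at_top sequentially"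
proof -
  have N: "N > 0" using \<open>N \<ge> 2\<close> by simp
  \<comment> \<open>The sequence with index \<open>j\<close> occupies the residue class of \<open>j - 1\<close> modulo \<open>N\<close>, its terms counted from \<open>k = 1\<close>.\<close>
  define S where "S i = T (Suc (i mod N)) (Suc (i div N))" for i
  have index: "Suc (i mod N) \<in> {1..N}" for i using N by (simp add: Suc_leI)
  have "\<exists>x. filterlim (\<lambda>i. norm (S i x)) at_top sequentially"
    using assms(7)
  proof (elim disjE conjE)
    assume "\<forall>j\<in>{1..N}. (\<Sum>k. 1 / ennreal (norm (T j (Suc k)))) < \<infinity>"
    then have fin: "(\<Sum>k. 1 / ennreal (norm (T j (Suc k)))) < \<infinity>" if "j \<in> {1..N}" for j
      using that by blast
    have pos: "norm (T j (Suc k)) > 0" and sum: "summable (\<lambda>k. 1 / norm (T j (Suc k)))"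
      if "j \<in> {1..N}" for j k
      using summable_inverse_if_ennreal_finite[OF norm_ge_zero fin[OF that]] by auto
    have "summable (\<lambda>i. 1 / norm (S i))"
      unfolding S_def
      by (rule summable_interleave[OF N, of "\<lambda>j k. 1 / norm (T (Suc j) (Suc k))"]) (auto intro: sum)
    moreover have "S i \<noteq> 0" for i using pos[OF index, of i "i div N"] by (simp add: S_def)
    ultimately show ?thesis by (intro banach_orbit_to_infinity)
  next
    assume hilbert: "complex_hilbert_space sX"
    assume "\<forall>j\<in>{1..N}. (\<Sum>k. 1 / (ennreal (norm (T j (Suc k))))\<^sup>2) < \<infinity>"
    then have fin: "(\<Sum>k. 1 / ennreal ((norm (T j (Suc k)))\<^sup>2)) < \<infinity>" if "j \<in> {1..N}" for j
      using that by (simp add: ennreal_power)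
    have pos: "(norm (T j (Suc k)))\<^sup>2 > 0" and sum: "summable (\<lambda>k. 1 / (norm (T j (Suc k)))\<^sup>2)"
      if "j \<in> {1..N}" for j k
      using summable_inverse_if_ennreal_finite[OF zero_le_power2 fin[OF that]] by auto
    have summable_S: "summable (\<lambda>i. 1 / (norm (S i))\<^sup>2)"
      unfolding S_def
      by (rule summable_interleave[OF N, of "\<lambda>j k. 1 / (norm (T (Suc j) (Suc k)))\<^sup>2"]) (auto intro: sum)
    have nz: "S i \<noteq> 0" for i using pos[OF index, of i "i div N"] by (simp add: S_def)
    obtain e ip where e: "\<And>c. norm (e c) = cmod c" and ip: "hilbert_space_over (\<lambda>c. sX (e c)) ip"
      using complex_hilbert_space_imp_complex_scalars[OF hilbert] by metis
    interpret Y: normed_space_over sY by fact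
    have "norm (S i (sX (e c) x)) = cmod c * norm (S i x)" for i c x
    proof -
      have "S i \<in> bounded_operators sX sY" unfolding S_def by (rule assms(6)[OF index]) simp
      then interpret L: Vector_Spaces.linear sX sY "blinfun_apply (S i)"
        by (simp add: bounded_operators_def)
      show ?thesis by (simp add: L.scale Y.norm_smul e)
    qed
    from hilbert_orbit_to_infinity[OF ip this nz summable_S] show ?thesis .
  qed
  then obtain x where x: "filterlim (\<lambda>i. norm (S i x)) at_top sequentially" ..
  have "filterlim (\<lambda>k. norm (T j k x)) at_top sequentially" if j: "j \<in> {1..N}" for j
  proof -
    obtain r where r: "j = Suc r" "r < N" using j by (cases j) auto
    have "strict_mono (\<lambda>k. k * N + r)" using N by (simp add: strict_mono_def)
    from filterlim_compose[OF x filterlim_subseq[OF this]]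
    have "filterlim (\<lambda>k. norm (S (k * N + r) x)) at_top sequentially" .
    moreover have "S (k * N + r) = T j (Suc k)" for k
      using r by (simp add: S_def)
    ultimately have "filterlim (\<lambda>k. norm (T j (Suc k) x)) at_top sequentially" by simp
    then show ?thesis by (simp only: filterlim_sequentially_Suc[of "\<lambda>k. norm (T j k x)"])
  qed
  then show ?thesis by blast
qed

end
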